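(* For every $2$-vertex-connected graph $G$ of order $n$, $rc(G) \leq \lceil n/2 \rceil + 1$.
   Context: All graphs are finite, simple and undirected. A path is a rainbow path if no two of its edges have the same colour. An edge colouring of a connected graph is a rainbow colouring if every pair of vertices is joined by at least one rainbow path. The rainbow connection number $rc(G)$ of a connected graph $G$ is the minimum number of colours in a rainbow colouring of $G$. A graph is $2$-vertex-connected if its vertex connectivity (the minimum number of vertices whose removal disconnects the graph) is at least $2$. *)

theory Defs
  imports Complex_Main
begin

definition simple_graph :: "'a set \<Rightarrow> 'a set set \<Rightarrow> bool" where
  "simple_graph V E \<longleftrightarrow> finite V \<and> (\<forall>e\<in>E. e \<subseteq> V \<and> card e = 2)"

(* A path is given by its nonempty list of pairwise distinct vertices; [u] is the path of length 0. *)
definition is_path :: "'a set \<Rightarrow> 'a set set \<Rightarrow> 'a list \<Rightarrow> bool" where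
  "is_path V E p \<longleftrightarrow>
     p \<noteq> [] \<and> set p \<subseteq> V \<and> distinct p \<and> successively (\<lambda>u v. {u, v} \<in> E) p"

definition path_joins :: "'a set \<Rightarrow> 'a set set \<Rightarrow> 'a \<Rightarrow> 'a list \<Rightarrow> 'a \<Rightarrow> bool" where
  "path_joins V E u p v \<longleftrightarrow> is_path V E p \<and> hd p = u \<and> last p = v"

definition path_edges :: "'a list \<Rightarrow> 'a set list" where
  "path_edges p = map2 (\<lambda>u v. {u, v}) p (tl p)"

definition connected_graph :: "'a set \<Rightarrow> 'a set set \<Rightarrow> bool" where
  "connected_graph V E \<longleftrightarrow> (\<forall>u\<in>V. \<forall>v\<in>V. \<exists>p. path_joins V E u p v)"

definition remove_vertices_edges :: "'a set set \<Rightarrow> 'a set \<Rightarrow> 'a set set" where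
  "remove_vertices_edges E S = {e \<in> E. e \<inter> S = {}}"

(* No vertex set disconnects a complete graph; as usual, reduction to at most one vertex counts
   as disconnecting, so that the complete graph on n > 0 vertices has connectivity n - 1. *)
definition disconnecting_set :: "'a set \<Rightarrow> 'a set set \<Rightarrow> 'a set \<Rightarrow> bool" where
  "disconnecting_set V E S \<longleftrightarrow> S \<subseteq> V \<and>
     (\<not> connected_graph (V - S) (remove_vertices_edges E S) \<or> card (V - S) \<le> 1)"

(* For finite V the set V itself is disconnecting, so this least number exists. *)
definition vertex_connectivity :: "'a set \<Rightarrow> 'a set set \<Rightarrow> nat" where
  "vertex_connectivity V E = (LEAST k. \<exists>S. disconnecting_set V E S \<and> card S = k)"

definition vertex_connected :: "nat \<Rightarrow> 'a set \<Rightarrow> 'a set set \<Rightarrow> bool" where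
  "vertex_connected k V E \<longleftrightarrow> vertex_connectivity V E \<ge> k"

definition rainbow_path :: "('a set \<Rightarrow> 'c) \<Rightarrow> 'a list \<Rightarrow> bool" where
  "rainbow_path c p \<longleftrightarrow> distinct (map c (path_edges p))"

definition rainbow_colouring :: "'a set \<Rightarrow> 'a set set \<Rightarrow> ('a set \<Rightarrow> 'c) \<Rightarrow> bool" where
  "rainbow_colouring V E c \<longleftrightarrow>
     (\<forall>u\<in>V. \<forall>v\<in>V. \<exists>p. path_joins V E u p v \<and> rainbow_path c p)"

(* Meaningful for connected graphs only: an injective colouring of a finite connected graph is a
   rainbow colouring, whereas a disconnected graph has none. Values of c off E are irrelevant. *)
definition rc :: "'a set \<Rightarrow> 'a set set \<Rightarrow> nat" where
  "rc V E = (LEAST k. \<exists>c :: 'a set \<Rightarrow> nat. rainbow_colouring V E c \<and> card (c ` E) = k)"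

end

theory Submission
  imports Defs
begin

text \<open>
  Colour the edges of an ear with \<open>N = 2h\<close> internal vertices, from one end to the other, by
  \<open>x\<^sub>1 \<dots> x\<^sub>h, y, x\<^sub>1 \<dots> x\<^sub>h\<close> with \<open>y\<close> an old colour: this keeps a colouring rainbow at the price of \<open>N/2\<close>
  new colours. An odd ear seems to cost \<open>(N+1)/2\<close>. However, an odd ear touching the
  interior of the ear added just before it costs only \<open>(N-1)/2\<close>: both edges at its middle vertex can be given existing colours.

  Take \<open>S\<close> maximal among the vertex sets that are rainbow connected in themselves by at most \<open>\<bar>S\<bar>/2\<close>
  colours. Then all ears of \<open>S\<close> are odd, and each component \<open>D\<close> of \<open>G - S\<close> is built from an odd ear of \<open>S\<close>
  by even ears only, since a second odd ear touching \<open>D\<close> would enlarge \<open>S\<close>. With two extra colours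
  \<open>z\<^sub>1, z\<^sub>2\<close>, shared by all components and put on the two middle edges of every such odd ear, \<open>D\<close> needs
  only \<open>(\<bar>D\<bar> - 1)/2\<close> private colours. If \<open>G - S\<close> is nonempty, this gives at most \<open>(n - 1)/2 + 2\<close> colours.
\<close>

section \<open>Walks with pairwise distinct edge colours\<close>

lemma path_edges_append: "path_edges (xs @ u # ys) = path_edges (xs @ [u]) @ path_edges (u # ys)"
proof (induction xs)
  case (Cons x xs)
  then show ?case by (cases xs) (simp_all add: path_edges_def)
qed (simp add: path_edges_def)

locale two_connected =
  fixes V :: "'a set" and E :: "'a set set"
  assumes simple: "simple_graph V E"
    and two_conn: "vertex_connected 2 V E"
begin

text \<open>\<open>rcon c X A u w\<close>: some walk in \<open>X\<close> from \<open>u\<close> to \<open>w\<close> has pairwise distinct edge colours, all in \<open>A\<close>.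
  Walks concatenate without a disjointness condition on vertices; a path is extracted only at the
  end.\<close>

inductive rcon :: "('a set \<Rightarrow> nat) \<Rightarrow> 'a set \<Rightarrow> nat set \<Rightarrow> 'a \<Rightarrow> 'a \<Rightarrow> bool" for c X where
  rcon_refl: "u \<in> X \<Longrightarrow> rcon c X A u u"
| rcon_step: "u \<in> X \<Longrightarrow> {u, v} \<in> E \<Longrightarrow> c {u, v} \<in> A \<Longrightarrow>
    rcon c X (A - {c {u, v}}) v w \<Longrightarrow> rcon c X A u w"

lemma rcon_in: "rcon c X A u w \<Longrightarrow> u \<in> X \<and> w \<in> X"
  by (induction rule: rcon.induct) auto

text \<open>Every edge of a walk in \<open>X\<close> is a subset of \<open>X\<close>, so only the
  colours inside \<open>X\<close> matter. This carries old walks over to an enlarged vertex set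
  after an ear has been coloured.\<close>

lemma rcon_transfer:
  assumes "rcon c X A u w" "X \<subseteq> Y" "A \<subseteq> B" "\<And>e. e \<subseteq> X \<Longrightarrow> c' e = c e"
  shows "rcon c' Y B u w"
  using assms(1,3)
proof (induction arbitrary: B rule: rcon.induct)
  case (rcon_refl u A)
  then show ?case using assms(2) rcon.rcon_refl by blast
next
  case (rcon_step u v A w)
  have "{u, v} \<subseteq> X" using rcon_step rcon_in by blast
  then have e: "c' {u, v} = c {u, v}" by (rule assms(4))
  show ?case
  proof (rule rcon.rcon_step[where v = v])
    show "u \<in> Y" using rcon_step assms(2) by blast
    show "{u, v} \<in> E" by fact
    show "c' {u, v} \<in> B" using e rcon_step by auto
    show "rcon c' Y (B - {c' {u, v}}) v w"
      by (rule rcon_step.IH) (use e rcon_step in auto)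
  qed
qed

lemma rcon_mono: "rcon c X A u w \<Longrightarrow> A \<subseteq> B \<Longrightarrow> rcon c X B u w"
  by (rule rcon_transfer) auto

lemma rcon_trans:
  assumes "rcon c X A u v" "rcon c X B v w" "A \<inter> B = {}"
  shows "rcon c X (A \<union> B) u w"
  using assms
proof (induction rule: rcon.induct)
  case (rcon_refl u A)
  then show ?case using rcon_mono by blast
next
  case (rcon_step u x A v)
  have "A \<union> B - {c {u, x}} = (A - {c {u, x}}) \<union> B" using rcon_step by auto
  moreover have "rcon c X ((A - {c {u, x}}) \<union> B) x w"
    using rcon_step by (intro rcon_step.IH) auto
  ultimately show ?case using rcon_step.hyps by (metis UnI1 rcon.rcon_step)
qed

lemma rcon_edge:
  assumes "u \<in> X" "w \<in> X" "{u, w} \<in> E" "c {u, w} \<in> A"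
  shows "rcon c X A u w"
  using assms by (metis rcon_refl rcon_step)

lemma rcon_sym: "rcon c X A u w \<Longrightarrow> rcon c X A w u"
proof (induction rule: rcon.induct)
  case (rcon_refl u A)
  then show ?case by (rule rcon.rcon_refl)
next
  case (rcon_step u v A w)
  have "rcon c X {c {u, v}} v u"
    using rcon_step rcon_in by (intro rcon_edge) (auto simp: insert_commute)
  then have "rcon c X ((A - {c {u, v}}) \<union> {c {u, v}}) w u"
    using rcon_step by (intro rcon_trans) auto
  then show ?case using rcon_step by (simp add: insert_absorb)
qed

text \<open>If the new first vertex \<open>u\<close> already lies on the path, the part before it is
  dropped; the remaining edges still have distinct colours from the same palette.\<close>

lemma rcon_path:
  assumes "rcon c X A u w"
  shows "\<exists>p. path_joins X E u p w \<and> rainbow_path c p \<and> c ` set (path_edges p) \<subseteq> A"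
  using assms
proof (induction rule: rcon.induct)
  case (rcon_refl u A)
  then show ?case
    by (intro exI[of _ "[u]"]) (auto simp: path_joins_def is_path_def rainbow_path_def path_edges_def)
next
  case (rcon_step u v A w)
  then obtain p where p: "path_joins X E v p w" "rainbow_path c p"
    "c ` set (path_edges p) \<subseteq> A - {c {u, v}}" by blast
  show ?case
  proof (cases "u \<in> set p")
    case True
    then obtain xs ys where s: "p = xs @ u # ys" by (meson split_list)
    have e: "path_edges p = path_edges (xs @ [u]) @ path_edges (u # ys)"
      unfolding s by (rule path_edges_append)
    show ?thesis
      using p e unfolding s
      by (intro exI[of _ "u # ys"])
        (auto simp: path_joins_def is_path_def rainbow_path_def successively_append_iff)
  next
    case False
    obtain ps where s: "p = v # ps" using p by (cases p) (auto simp: path_joins_def is_path_def)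
    show ?thesis
      using p False rcon_step unfolding s
      by (intro exI[of _ "u # v # ps"])
        (auto simp: path_joins_def is_path_def rainbow_path_def path_edges_def)
  qed
qed

section \<open>Ears: recolouring and reversal\<close>

text \<open>\<open>N\<close> counts the internal vertices of the ear, so the ends are \<open>v 0\<close> and \<open>v (Suc N)\<close>.\<close>

definition ear :: "'a set \<Rightarrow> (nat \<Rightarrow> 'a) \<Rightarrow> nat \<Rightarrow> bool" where
  "ear X v N \<longleftrightarrow> 0 < N \<and> v 0 \<in> X \<and> v (Suc N) \<in> X \<and> v 0 \<noteq> v (Suc N) \<and>
     inj_on v {1..N} \<and> v ` {1..N} \<subseteq> V - X \<and> (\<forall>i\<le>N. {v i, v (Suc i)} \<in> E)"

lemma ear_inj:
  assumes "ear X v N"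
  shows "inj_on v {..Suc N}"
proof (rule inj_onI)
  fix i j assume ij: "i \<in> {..Suc N}" "j \<in> {..Suc N}" "v i = v j"
  have mem: "v k \<in> X \<longleftrightarrow> k = 0 \<or> k = Suc N" if "k \<le> Suc N" for k
  proof (cases "k = 0 \<or> k = Suc N")
    case False
    then have "k \<in> {1..N}" using that by auto
    then show ?thesis using assms False unfolding ear_def by blast
  qed (use assms ear_def in auto)
  show "i = j"
  proof (cases "v i \<in> X")
    case True
    then show ?thesis using mem[of i] mem[of j] ij assms unfolding ear_def by auto
  next
    case False
    then have "i \<in> {1..N}" "j \<in> {1..N}" using mem[of i] mem[of j] ij by auto
    then show ?thesis using assms ij unfolding ear_def inj_on_def by blast
  qed
qed

text \<open>Distinct indices give distinct ear edges, and none of them lies inside \<open>X\<close>,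
  so the colours along the ear can be prescribed freely while \<open>c\<close> survives inside
  \<open>X\<close>.\<close>

lemma ear_recolour:
  assumes "ear X v N"
  obtains c' :: "'a set \<Rightarrow> nat" where "\<And>i. i \<le> N \<Longrightarrow> c' {v i, v (Suc i)} = k i"
    "\<And>e. e \<subseteq> X \<Longrightarrow> c' e = c e"
proof -
  let ?P = "\<lambda>e i. i \<le> N \<and> e = {v i, v (Suc i)}"
  define c' where "c' e = (if \<exists>i. ?P e i then k (LEAST i. ?P e i) else c e)" for e
  have inj: "inj_on v {..Suc N}" using assms by (rule ear_inj)
  have "c' {v i, v (Suc i)} = k i" if i: "i \<le> N" for i
  proof -
    have "j = i" if "?P {v i, v (Suc i)} j" for j
    proof -
      have "(v i = v j \<and> v (Suc i) = v (Suc j)) \<or> (v i = v (Suc j) \<and> v (Suc i) = v j)"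
        using that by (auto simp: doubleton_eq_iff)
      then have "i = j \<or> (i = Suc j \<and> Suc i = j)"
        using inj i that unfolding inj_on_def by (metis atMost_iff le_SucI Suc_le_mono)
      then show ?thesis by auto
    qed
    then have "(LEAST j. ?P {v i, v (Suc i)} j) = i"
      using i by (intro Least_equality) auto
    then show ?thesis using i unfolding c'_def by auto
  qed
  moreover have "c' e = c e" if "e \<subseteq> X" for e
  proof -
    have False if "?P e i" for i
    proof -
      have "v i \<notin> X \<or> v (Suc i) \<notin> X"
      proof (cases "i = 0")
        case True
        then have "Suc i \<in> {1..N}" using assms unfolding ear_def by auto
        then show ?thesis using assms unfolding ear_def by blast
      next
        case False
        then have "i \<in> {1..N}" using that by auto
        then show ?thesis using assms unfolding ear_def by blast
      qed
      then show False using that \<open>e \<subseteq> X\<close> by auto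
    qed
    then show ?thesis unfolding c'_def by auto
  qed
  ultimately show ?thesis using that by blast
qed

lemma ear_rev_image:
  fixes v :: "nat \<Rightarrow> 'a"
  shows "(\<lambda>i. v (Suc N - i)) ` {1..N} = v ` {1..N}"
proof -
  have "(\<lambda>i. Suc N - i) ` {1..N} = {1..N}"
  proof (intro equalityI subsetI)
    fix x assume "x \<in> {1..N}"
    then have "x = Suc N - (Suc N - x)" "Suc N - x \<in> {1..N}" by auto
    then show "x \<in> (\<lambda>i. Suc N - i) ` {1..N}" by blast
  qed auto
  then show ?thesis by (metis image_image)
qed

lemma ear_rev:
  assumes "ear X v N"
  shows "ear X (\<lambda>i. v (Suc N - i)) N"
proof -
  have "inj_on (\<lambda>i. v (Suc N - i)) {1..N}"
  proof (rule inj_onI)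
    fix x y assume xy: "x \<in> {1..N}" "y \<in> {1..N}" "v (Suc N - x) = v (Suc N - y)"
    then have "Suc N - x = Suc N - y"
      using ear_inj[OF assms] unfolding inj_on_def by auto
    then show "x = y" using xy by auto
  qed
  moreover have "{v (Suc N - i), v (Suc N - Suc i)} \<in> E" if "i \<le> N" for i
  proof -
    have "{v (N - i), v (Suc (N - i))} \<in> E" using assms unfolding ear_def by auto
    then show ?thesis using that by (simp add: Suc_diff_le insert_commute)
  qed
  ultimately show ?thesis using assms ear_rev_image[of v N] unfolding ear_def by auto
qed

end

subsection \<open>Ears coloured symmetrically\<close>

text \<open>The edge colours along the ear are \<open>y 0, \<dots>, y (h - 1)\<close>, then \<open>d - h\<close> old colours \<open>\<mu>\<close>, then again
  \<open>y 0, \<dots>, y (h - 1)\<close>. A vertex at position \<open>i \<le> h\<close> reaches \<open>v 0\<close> and one at position \<open>j \<ge> d\<close> reaches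
  \<open>v (Suc N)\<close> in the new colours only; the two are joined along the ear if \<open>j - d \<le> i\<close>, and through
  the old part otherwise.\<close>

locale patterned_ear = two_connected V E for V :: "'a set" and E +
  fixes X :: "'a set" and v :: "nat \<Rightarrow> 'a" and N h d :: nat
    and c :: "'a set \<Rightarrow> nat" and y \<mu> :: "nat \<Rightarrow> nat" and P :: "nat set"
  assumes ear: "ear X v N" and len: "Suc N = h + d" "h \<le> d" "d \<le> h + 2"
    and col: "\<And>i. i \<le> N \<Longrightarrow>
      c {v i, v (Suc i)} = (if i < h then y i else if i < d then \<mu> i else y (i - d))"
    and inj_y: "inj y" and inj_mu: "inj_on \<mu> {h..<d}"
    and mu_P: "\<mu> ` {h..<d} \<subseteq> P" and y_P: "range y \<inter> P = {}"
begin

abbreviation "\<kappa> i \<equiv> if i < h then y i else if i < d then \<mu> i else y (i - d)"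

abbreviation "W \<equiv> X \<union> v ` {1..N}"

lemma vertex_W: "i \<le> Suc N \<Longrightarrow> v i \<in> W"
  using ear by (cases "i = 0 \<or> i = Suc N") (auto simp: ear_def)

lemma y_mu: "h \<le> j \<Longrightarrow> j < d \<Longrightarrow> y i \<noteq> \<mu> j"
  using mu_P y_P by (metis IntI atLeastLessThan_iff empty_iff image_subset_iff rangeI)

lemma segment:
  assumes "i \<le> j" "j \<le> Suc N" "inj_on \<kappa> {i..<j}"
  shows "rcon c W (\<kappa> ` {i..<j}) (v i) (v j)"
  using assms
proof (induction rule: inc_induct)
  case base
  then show ?case by (intro rcon_refl vertex_W)
next
  case (step n)
  have s: "{n..<j} = insert n {Suc n..<j}" using step by auto
  have "inj_on \<kappa> {Suc n..<j}" by (rule inj_on_subset[OF step.prems(2)]) auto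
  then have r: "rcon c W (\<kappa> ` {Suc n..<j}) (v (Suc n)) (v j)" using step by blast
  have c: "c {v n, v (Suc n)} = \<kappa> n" using col[of n] step by auto
  have "\<kappa> n \<notin> \<kappa> ` {Suc n..<j}"
  proof
    assume "\<kappa> n \<in> \<kappa> ` {Suc n..<j}"
    then obtain t where t: "t \<in> {Suc n..<j}" "\<kappa> n = \<kappa> t" by blast
    have "n = t" by (rule inj_onD[OF step.prems(2) t(2)]) (use t step in auto)
    then show False using t by simp
  qed
  then have "\<kappa> ` {Suc n..<j} \<subseteq> \<kappa> ` {n..<j} - {\<kappa> n}" unfolding s by blast
  with r have r': "rcon c W (\<kappa> ` {n..<j} - {c {v n, v (Suc n)}}) (v (Suc n)) (v j)"
    unfolding c by (rule rcon_mono)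
  have e: "{v n, v (Suc n)} \<in> E" using ear step unfolding ear_def by auto
  have a: "c {v n, v (Suc n)} \<in> \<kappa> ` {n..<j}" unfolding c s by blast
  have "v n \<in> W" using step by (intro vertex_W) auto
  then show ?case by (rule rcon_step[OF _ e a r'])
qed

lemma segment_subset:
  assumes "i \<le> j" "j \<le> Suc N" "inj_on \<kappa> {i..<j}" "\<kappa> ` {i..<j} \<subseteq> A"
  shows "rcon c W A (v i) (v j)"
  using segment[OF assms(1-3)] assms(4) by (rule rcon_mono)

text \<open>Along the ear a colour recurs only at distance \<open>d\<close>, so a stretch without
  two edges \<open>d\<close> apart is rainbow. The edges before position \<open>d\<close> form such
  a stretch, and so do those from position \<open>h\<close> on.\<close>

lemma inj_low: "inj_on \<kappa> {..<d}"
proof (rule inj_onI)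
  fix i j assume ij: "i \<in> {..<d}" "j \<in> {..<d}" "\<kappa> i = \<kappa> j"
  consider "i < h" "j < h" | "i < h" "h \<le> j" | "h \<le> i" "j < h" | "h \<le> i" "h \<le> j" by linarith
  then show "i = j"
  proof cases
    case 1 then show ?thesis using ij inj_y by (simp add: inj_eq)
  next
    case 2 then show ?thesis using ij y_mu[of j i] by simp
  next
    case 3 then show ?thesis using ij y_mu[of i j] by simp
  next
    case 4 then show ?thesis using ij inj_mu by (simp add: inj_on_eq_iff)
  qed
qed

lemma inj_high: "inj_on \<kappa> {h..Suc N}"
proof (rule inj_onI)
  fix i j assume ij: "i \<in> {h..Suc N}" "j \<in> {h..Suc N}" "\<kappa> i = \<kappa> j"
  consider "i < d" "j < d" | "i < d" "d \<le> j" | "d \<le> i" "j < d" | "d \<le> i" "d \<le> j" by linarith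
  then show "i = j"
  proof cases
    case 1 then show ?thesis using ij inj_mu by (simp add: inj_on_eq_iff)
  next
    case 2 then show ?thesis using ij y_mu[of i "j - d"] len by simp
  next
    case 3 then show ?thesis using ij y_mu[of j "i - d"] len by simp
  next
    case 4 then show ?thesis using ij inj_y len by (simp add: inj_eq)
  qed
qed

lemma left_segment:
  assumes "i \<le> j" "j \<le> h" "y ` {i..<j} \<subseteq> A"
  shows "rcon c W A (v i) (v j)"
  using assms len by (intro segment_subset inj_on_subset[OF inj_low]) auto

lemma right_segment:
  assumes "d \<le> i" "i \<le> j" "j \<le> Suc N" "y ` {i - d..<j - d} \<subseteq> A"
  shows "rcon c W A (v i) (v j)"
proof (rule segment_subset)
  show "\<kappa> ` {i..<j} \<subseteq> A"
  proof
    fix x assume "x \<in> \<kappa> ` {i..<j}"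
    then obtain t where "i \<le> t" "t < j" "x = y (t - d)" using assms len by auto
    moreover have "t - d \<in> {i - d..<j - d}" using assms \<open>i \<le> t\<close> \<open>t < j\<close> by auto
    ultimately show "x \<in> A" using assms(4) by blast
  qed
qed (use assms len in \<open>auto intro: inj_on_subset[OF inj_high]\<close>)

lemma low_segment:
  assumes "i \<le> j" "j \<le> d" "y ` {i..<h} \<subseteq> A" "\<mu> ` {h..<j} \<subseteq> A"
  shows "rcon c W A (v i) (v j)"
  using assms len by (intro segment_subset inj_on_subset[OF inj_low]) auto

lemma high_segment:
  assumes "h \<le> i" "i \<le> j" "j \<le> Suc N" "y ` {..<j - d} \<subseteq> A" "\<mu> ` {i..<d} \<subseteq> A"
  shows "rcon c W A (v i) (v j)"
proof (rule segment_subset)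
  show "\<kappa> ` {i..<j} \<subseteq> A"
  proof
    fix x assume "x \<in> \<kappa> ` {i..<j}"
    then obtain t where t: "i \<le> t" "t < j" "x = \<kappa> t" by auto
    show "x \<in> A"
    proof (cases "t < d")
      case True
      then show ?thesis using t assms by auto
    next
      case False
      then have "t - d \<in> {..<j - d}" using t by auto
      then show ?thesis using False t assms len by auto
    qed
  qed
qed (use assms len in \<open>auto intro: inj_on_subset[OF inj_high]\<close>)

text \<open>Equally coloured edges have indices \<open>s\<close> and \<open>s + d\<close> with
  \<open>s < h\<close>. Both lie in the stretch only if \<open>i \<le> s < j - d\<close>, which
  \<open>j - d \<le> i\<close> excludes.\<close>

lemma cross_segment:
  assumes "i \<le> h" "d \<le> j" "j \<le> Suc N" "j - d \<le> i"
    and "y ` {i..<h} \<subseteq> A" "y ` {..<j - d} \<subseteq> A" "\<mu> ` {h..<d} \<subseteq> A"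
  shows "rcon c W A (v i) (v j)"
proof (rule segment_subset)
  show "i \<le> j" using assms len by auto
  show "j \<le> Suc N" by fact
  show "inj_on \<kappa> {i..<j}"
  proof (rule inj_onI)
    fix s t assume st: "s \<in> {i..<j}" "t \<in> {i..<j}" "\<kappa> s = \<kappa> t"
    consider "s < d" "t < d" | "s \<ge> h" "t \<ge> h" | "s < h" "t \<ge> d" | "t < h" "s \<ge> d"
      using len by linarith
    then show "s = t"
    proof cases
      case 1 then show ?thesis using st inj_onD[OF inj_low st(3)] by simp
    next
      case 2 then show ?thesis using st assms(3) inj_onD[OF inj_high st(3)] by simp
    next
      case 3
      then have "y s = y (t - d)" using st len by auto
      then have "s = t - d" using inj_y by (simp add: inj_eq)
      then show ?thesis using 3 st assms by auto
    next
      case 4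
      then have "y t = y (s - d)" using st len by auto
      then have "t = s - d" using inj_y by (simp add: inj_eq)
      then show ?thesis using 4 st assms by auto
    qed
  qed
  show "\<kappa> ` {i..<j} \<subseteq> A"
  proof
    fix x assume "x \<in> \<kappa> ` {i..<j}"
    then obtain t where t: "i \<le> t" "t < j" "x = \<kappa> t" by auto
    consider "t < h" | "h \<le> t" "t < d" | "d \<le> t" by linarith
    then show "x \<in> A"
    proof cases
      case 1 then show ?thesis using t assms by auto
    next
      case 2 then show ?thesis using t assms by auto
    next
      case 3
      then have "t - d \<in> {..<j - d}" using t by auto
      then show ?thesis using 3 t assms len by auto
    qed
  qed
qed

lemma left_out:
  assumes "i \<le> h" "y ` {..<i} \<subseteq> A" shows "rcon c W A (v i) (v 0)"
  using assms by (intro rcon_sym[OF left_segment]) auto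

lemma right_out:
  assumes "d \<le> j" "j \<le> Suc N" "y ` {j - d..<h} \<subseteq> A" shows "rcon c W A (v j) (v (Suc N))"
  using assms len by (intro right_segment) auto

lemma W_cases:
  assumes "w \<in> W"
  obtains "w \<in> X" | i where "w = v i" "1 \<le> i" "i \<le> h" | i where "w = v i" "h < i" "i < d"
    | j where "w = v j" "d \<le> j" "h < j" "j \<le> N"
proof (cases "w \<in> X")
  case False
  then obtain i where "w = v i" "1 \<le> i" "i \<le> N" using assms by auto
  then show ?thesis using that(2-4)[of i] by linarith
qed (rule that(1))

definition newP :: "nat set" where "newP = P \<union> y ` {..<h}"

text \<open>The vertices strictly between positions \<open>h\<close> and \<open>d\<close> exist only for \<open>d = h + 2\<close>: this is the
  middle vertex of an odd ear both of whose edges have old colours.\<close>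

lemma all_pairs:
  assumes X: "\<And>u w. u \<in> X \<Longrightarrow> w \<in> X \<Longrightarrow> rcon c W P u w"
    and mid: "\<And>i w. h < i \<Longrightarrow> i < d \<Longrightarrow> w \<in> X \<Longrightarrow> rcon c W newP (v i) w"
    and "u \<in> W" "w \<in> W"
  shows "rcon c W newP u w"
proof -
  have e0: "v 0 \<in> X" and e1: "v (Suc N) \<in> X" using ear by (auto simp: ear_def)
  have yP: "y ` A \<inter> P = {}" for A using y_P by auto
  have X': "rcon c W newP u w" if "u \<in> X" "w \<in> X" for u w
    using X[OF that] by (rule rcon_mono) (auto simp: newP_def)
  have l: "rcon c W newP (v i) w" if "w \<in> X" "i \<le> h" for i w
    by (rule rcon_mono[OF rcon_trans[OF left_out[OF that(2) order_refl] X[OF e0 that(1)] yP]])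
      (use that in \<open>auto simp: newP_def\<close>)
  have r: "rcon c W newP (v j) w" if "w \<in> X" "d \<le> j" "j \<le> N" for j w
    by (rule rcon_mono[OF rcon_trans[OF right_out[OF that(2) _ order_refl] X[OF e1 that(1)] yP]])
      (use that in \<open>auto simp: newP_def\<close>)
  have ll: "rcon c W newP (v i) (v j)" if "i \<le> j" "j \<le> d" for i j
    using that mu_P by (intro low_segment) (auto simp: newP_def)
  have rr: "rcon c W newP (v i) (v j)" if "h \<le> i" "i \<le> j" "j \<le> N" for i j
    using that mu_P len by (intro high_segment) (auto simp: newP_def)
  have ll': "rcon c W newP (v i) (v j)" if "i \<le> d" "j \<le> d" for i j
    using ll[of i j] ll[of j i] that rcon_sym by (meson linear)
  have rr': "rcon c W newP (v i) (v j)" if "h \<le> i" "i \<le> N" "h \<le> j" "j \<le> N" for i j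
    using rr[of i j] rr[of j i] that rcon_sym by (meson linear)
  have lr: "rcon c W newP (v i) (v j)" if "i \<le> h" "d \<le> j" "j \<le> N" for i j
  proof (cases "j - d \<le> i")
    case True
    then show ?thesis using that mu_P len by (intro cross_segment) (auto simp: newP_def)
  next
    case False
    \<comment> \<open>The route leaves through \<open>v 0\<close>, crosses \<open>X\<close> and
      returns through \<open>v (Suc N)\<close>. Since \<open>i < j - d\<close>, its two parts on the
      ear use disjoint index ranges of \<open>y\<close>.\<close>
    have 1: "rcon c W (y ` {..<i} \<union> P) (v i) (v (Suc N))"
      by (rule rcon_trans[OF left_out[OF that(1) order_refl] X[OF e0 e1] yP])
    have 2: "rcon c W (y ` {j - d..<h}) (v (Suc N)) (v j)"
      using that by (intro rcon_sym[OF right_out]) auto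
    have "rcon c W (y ` {..<i} \<union> P \<union> y ` {j - d..<h}) (v i) (v j)"
    proof (rule rcon_trans[OF 1 2])
      have "y ` {..<i} \<inter> y ` {j - d..<h} = {}"
        using False inj_y by (auto simp: inj_eq)
      then show "(y ` {..<i} \<union> P) \<inter> y ` {j - d..<h} = {}" using yP by blast
    qed
    then show ?thesis by (rule rcon_mono) (use that in \<open>auto simp: newP_def\<close>)
  qed
  show ?thesis
    using assms(3)
  proof (cases rule: W_cases)
    case 1
    show ?thesis using assms(4)
      by (cases rule: W_cases) (use 1 X' mid l r rcon_sym in blast)+
  next
    case (2 i)
    show ?thesis using assms(4)
    proof (cases rule: W_cases)
      case 1 then show ?thesis using 2 l by blast
    next
      case (2 j) then show ?thesis using \<open>u = v i\<close> \<open>i \<le> h\<close> ll' len by auto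
    next
      case (3 j) then show ?thesis using \<open>u = v i\<close> \<open>i \<le> h\<close> ll' len by auto
    next
      case (4 j) then show ?thesis using \<open>u = v i\<close> \<open>i \<le> h\<close> lr by auto
    qed
  next
    case (3 i)
    show ?thesis using assms(4)
    proof (cases rule: W_cases)
      case 1 then show ?thesis using 3 mid by blast
    next
      case (2 j) then show ?thesis using 3 ll' len by auto
    next
      case (3 j) then show ?thesis using \<open>u = v i\<close> \<open>i < d\<close> ll' len by auto
    next
      case (4 j) then show ?thesis using 3 rr' len by auto
    qed
  next
    case (4 i)
    show ?thesis using assms(4)
    proof (cases rule: W_cases)
      case 1 then show ?thesis using 4 r by blast
    next
      case (2 j) then show ?thesis using 4 lr rcon_sym by blast
    next
      case (3 j) then show ?thesis using 4 rr' len by auto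
    next
      case (4 j) then show ?thesis using \<open>u = v i\<close> \<open>h < i\<close> \<open>i \<le> N\<close> rr' len by auto
    qed
  qed
qed

lemma yP_empty: "y ` A \<inter> P = {}"
  using y_P by auto

text \<open>The next two lemmas say which old vertices and ear vertices a further odd ear with ends \<open>v i\<close>
  and \<open>e\<close> (resp. \<open>v i\<close> and \<open>v j\<close>) can reach from its middle vertex, if the two edges there are given
  the two excluded colours.\<close>

lemma cover_low:
  assumes X: "\<And>u w. u \<in> X \<Longrightarrow> w \<in> X \<Longrightarrow> rcon c W P u w"
    and d: "d \<le> h + 1" and g: "g \<in> P" "g \<notin> \<mu> ` {h..<d}"
    and i: "1 \<le> i" "i \<le> d" and e: "e \<in> X \<or> (\<exists>j. e = v j \<and> d < j \<and> j \<le> N)"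
    and w: "w \<in> W"
  shows "rcon c W (newP - {g}) (v i) w \<or> rcon c W (newP - {y 0}) e w"
proof -
  have e1: "v (Suc N) \<in> X" using ear by (auto simp: ear_def)
  have gy: "y k \<noteq> g" for k using g y_P by auto
  have yy: "y k = y l \<longleftrightarrow> k = l" for k l using inj_y by (simp add: inj_eq)
  have P0: "P \<subseteq> newP - {y 0}" using y_P by (auto simp: newP_def)
  have up: "rcon c W (newP - {y 0}) (v (Suc N)) (v j) " if "d < j" "j \<le> N" for j
    using that len by (intro rcon_sym[OF right_out]) (auto simp: newP_def yy)
  \<comment> \<open>From a position \<open>j > d\<close> the walk to the right end starts with
    \<open>y (j - d)\<close> and uses only larger indices, hence never \<open>y 0\<close>.\<close>
  have eX: "rcon c W (newP - {y 0}) e u" if u: "u \<in> X" for u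
  proof (cases "e \<in> X")
    case True
    then show ?thesis using rcon_mono[OF X P0] u by blast
  next
    case False
    then obtain j where j: "e = v j" "d < j" "j \<le> N" using e by blast
    have "rcon c W (y ` {j - d..<h} \<union> P) (v j) u"
      using j by (intro rcon_trans[OF right_out X[OF e1 u] yP_empty]) auto
    then show ?thesis unfolding j(1) by (rule rcon_mono) (use j P0 in \<open>auto simp: newP_def yy\<close>)
  qed
  show ?thesis
  proof (cases "w \<in> X")
    case True then show ?thesis using eX by blast
  next
    case False
    then obtain k where k: "w = v k" "1 \<le> k" "k \<le> N" using w by auto
    show ?thesis
    proof (cases "k \<le> d")
      case True
      \<comment> \<open>Up to position \<open>d\<close> only colours of \<open>y\<close> and
        \<open>\<mu>\<close> occur, and \<open>g\<close> is neither.\<close>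
      have A: "rcon c W (newP - {g}) (v s) (v t)" if "s \<le> t" "t \<le> d" for s t
        using that g mu_P gy by (intro low_segment) (auto simp: newP_def)
      show ?thesis
        using A[of i k] A[of k i] rcon_sym i True unfolding k(1) by (meson linear)
    next
      case False
      have "rcon c W (newP - {y 0}) e w"
      proof (cases "e \<in> X")
        case True
        have "rcon c W (P \<union> y ` {k - d..<h}) e (v k)"
          using k False yP_empty[of "{k - d..<h}"]
          by (intro rcon_trans[OF X[OF True e1] rcon_sym[OF right_out]]) auto
        then show ?thesis unfolding k(1)
          by (rule rcon_mono) (use k False P0 in \<open>auto simp: newP_def yy\<close>)
      next
        case nX: False
        then obtain j where j: "e = v j" "d < j" "j \<le> N" using e by blast
        have A: "rcon c W (newP - {y 0}) (v s) (v t)" if "d < s" "s \<le> t" "t \<le> N" for s t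
          using that len by (intro right_segment) (auto simp: newP_def yy)
        show ?thesis
          using A[of j k] A[of k j] rcon_sym j k False unfolding j(1) k(1) by (meson linear not_le)
      qed
      then show ?thesis ..
    qed
  qed
qed

lemma cover_left:
  assumes X: "\<And>u w. u \<in> X \<Longrightarrow> w \<in> X \<Longrightarrow> rcon c W P u w"
    and d: "d \<le> h + 1" and g: "g \<in> P" "g \<notin> \<mu> ` {h..<d}"
    and i: "i < j" "j \<le> h" and w: "w \<in> W"
  shows "rcon c W (newP - {y i}) (v i) w \<or> rcon c W (newP - {g}) (v j) w"
proof -
  have e0: "v 0 \<in> X" and e1: "v (Suc N) \<in> X" using ear by (auto simp: ear_def)
  have gy: "y k \<noteq> g" for k using g y_P by auto
  have yy: "y k = y l \<longleftrightarrow> k = l" for k l using inj_y by (simp add: inj_eq)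
  have Pi: "P \<subseteq> newP - {y i}" using y_P by (auto simp: newP_def)
  \<comment> \<open>The way left from \<open>v i\<close> uses only \<open>y k\<close> with
    \<open>k < i\<close>, which leaves \<open>y i\<close> free.\<close>
  have iX: "rcon c W (y ` {..<i} \<union> P) (v i) u" if u: "u \<in> X" for u
    using i by (intro rcon_trans[OF left_out X[OF e0 u] yP_empty]) auto
  show ?thesis
  proof (cases "w \<in> X")
    case True
    then have "rcon c W (newP - {y i}) (v i) w"
      by (intro rcon_mono[OF iX]) (use i Pi in \<open>auto simp: newP_def yy\<close>)
    then show ?thesis ..
  next
    case False
    then obtain k where k: "w = v k" "1 \<le> k" "k \<le> N" using w by auto
    consider "k \<le> h" | "h < k" "k - d \<le> j" | "h < k" "j < k - d" by linarith
    then show ?thesis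
    proof cases
      case 1
      have A: "rcon c W (newP - {g}) (v s) (v t)" if "s \<le> t" "t \<le> h" for s t
        using that gy by (intro left_segment) (auto simp: newP_def)
      show ?thesis using A[of j k] A[of k j] rcon_sym i 1 unfolding k(1) by (meson linear)
    next
      case 2
      have "rcon c W (newP - {g}) (v j) (v k)"
        using 2 k i d g gy mu_P len by (intro cross_segment) (auto simp: newP_def)
      then show ?thesis unfolding k(1) ..
    next
      case 3
      have "rcon c W (y ` {k - d..<h}) (v (Suc N)) (v k)"
        using 3 k d by (intro rcon_sym[OF right_out]) auto
      moreover have "y ` {..<i} \<inter> y ` {k - d..<h} = {}"
        using 3 i by (auto simp: yy)
      then have "(y ` {..<i} \<union> P) \<inter> y ` {k - d..<h} = {}" using yP_empty by blast
      ultimately have "rcon c W (y ` {..<i} \<union> P \<union> y ` {k - d..<h}) (v i) (v k)"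
        by (rule rcon_trans[OF iX[OF e1]])
      then have "rcon c W (newP - {y i}) (v i) (v k)"
        by (rule rcon_mono) (use 3 i Pi in \<open>auto simp: newP_def yy\<close>)
      then show ?thesis unfolding k(1) ..
    qed
  qed
qed

end

section \<open>Extending a rainbow colouring by one ear or by two\<close>

context two_connected
begin

definition rainbow_on :: "('a set \<Rightarrow> nat) \<Rightarrow> 'a set \<Rightarrow> nat set \<Rightarrow> bool" where
  "rainbow_on c X P \<longleftrightarrow> (\<forall>u\<in>X. \<forall>w\<in>X. rcon c X P u w)"

lemma rainbow_onD: "rainbow_on c X P \<Longrightarrow> u \<in> X \<Longrightarrow> w \<in> X \<Longrightarrow> rcon c X P u w"
  by (simp add: rainbow_on_def)

lemma pattern_exists:
  assumes "ear X v N" "Suc N = h + d" "h \<le> d" "d \<le> h + 2"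
    and "inj_on \<mu> {h..<d}" "\<mu> ` {h..<d} \<subseteq> P" "finite P"
  obtains c' y where "patterned_ear V E X v N h d c' y \<mu> P" "\<And>e. e \<subseteq> X \<Longrightarrow> c' e = c e"
proof -
  \<comment> \<open>The new colours exceed all old ones; inserting 0 keeps \<open>Max\<close>
    meaningful if \<open>P\<close> is empty.\<close>
  define y where "y i = Suc (Max (insert 0 P)) + i" for i
  have "y i \<notin> P" for i
  proof
    assume "y i \<in> P"
    then have "y i \<le> Max (insert 0 P)" using assms by auto
    then show False unfolding y_def by simp
  qed
  then have "range y \<inter> P = {}" by blast
  moreover have "inj y" unfolding y_def by (auto intro: injI)
  moreover obtain c' where "\<And>i. i \<le> N \<Longrightarrow>
      c' {v i, v (Suc i)} = (if i < h then y i else if i < d then \<mu> i else y (i - d))"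
    "\<And>e. e \<subseteq> X \<Longrightarrow> c' e = c e"
    by (rule ear_recolour[OF assms(1),
          where k = "\<lambda>i. if i < h then y i else if i < d then \<mu> i else y (i - d)" and c = c]) (rule that)
  ultimately show ?thesis
    using that[of c' y] assms two_connected_axioms
    by (auto simp: patterned_ear_def patterned_ear_axioms_def)
qed

text \<open>For odd \<open>N\<close> the pattern has no middle edge (\<open>d = h\<close>); for even
  \<open>N\<close> it has one (\<open>d = h + 1\<close>), which reuses an old colour
  \<open>p\<close>. The last clause feeds the tethering of new vertices to \<open>S\<close>.\<close>

lemma extend_ear:
  assumes rb: "rainbow_on c X P" and P: "finite P" "P \<noteq> {}" and ear: "ear X v N"
  obtains c' Y where "rainbow_on c' (X \<union> v ` {1..N}) (P \<union> Y)" "finite Y" "card Y = Suc N div 2"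
    "Y \<inter> P = {}" "\<And>e. e \<subseteq> X \<Longrightarrow> c' e = c e"
    "\<And>x. x \<in> v ` {1..N} \<Longrightarrow> \<exists>e\<in>{v 0, v (Suc N)}. rcon c' (X \<union> v ` {1..N}) Y x e"
proof -
  define h where "h = Suc N div 2"
  define d where "d = Suc N - h"
  obtain p where p: "p \<in> P" using P by blast
  have hd: "Suc N = h + d" "h \<le> d" "d \<le> h + 1" unfolding h_def d_def by auto
  have inj: "inj_on (\<lambda>_. p) {h..<d}" using hd by (auto simp: inj_on_def)
  obtain c' y where pe: "patterned_ear V E X v N h d c' y (\<lambda>_. p) P"
    and c': "\<And>e. e \<subseteq> X \<Longrightarrow> c' e = c e"
    using pattern_exists[OF ear hd(1,2) _ inj, of P c] p P hd by auto
  interpret pe: patterned_ear V E X v N h d c' y "\<lambda>_. p" P by fact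
  have X: "rcon c' pe.W P u w" if "u \<in> X" "w \<in> X" for u w
    by (rule rcon_transfer[OF rainbow_onD[OF rb that]]) (use c' in auto)
  show ?thesis
  proof (rule that[of c' "y ` {..<h}"])
    show "rainbow_on c' pe.W (P \<union> y ` {..<h})"
      using pe.all_pairs[OF X] hd unfolding rainbow_on_def pe.newP_def by auto
    show "card (y ` {..<h}) = Suc N div 2"
      using card_image[OF inj_on_subset[OF pe.inj_y], of "{..<h}"] by (simp add: h_def)
    fix x assume "x \<in> v ` {1..N}"
    then obtain i where i: "x = v i" "1 \<le> i" "i \<le> N" by auto
    show "\<exists>e\<in>{v 0, v (Suc N)}. rcon c' pe.W (y ` {..<h}) x e"
    proof (cases "i \<le> h")
      case True
      then have "rcon c' pe.W (y ` {..<h}) x (v 0)" unfolding i by (intro pe.left_out) auto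
      then show ?thesis by blast
    next
      case False
      then have "rcon c' pe.W (y ` {..<h}) x (v (Suc N))"
        unfolding i using i hd by (intro pe.right_out) auto
      then show ?thesis by blast
    qed
  qed (use c' pe.yP_empty in auto)
qed

text \<open>One colour is saved over \<open>extend_ear\<close> by taking \<open>d = h + 2\<close>.
  The middle vertex leaves towards \<open>v 0\<close> over an edge of colour \<open>g1\<close> and
  towards \<open>v (Suc N)\<close> over one of colour \<open>g2\<close>; \<open>cover\<close>
  continues from the end reached without that colour.\<close>

lemma extend_odd_ear:
  assumes rb: "rainbow_on c X P" and P: "finite P" "g1 \<in> P" "g2 \<in> P" "g1 \<noteq> g2"
    and ear: "ear X v N" "odd N"
    and cover: "\<And>w. w \<in> X \<Longrightarrow> rcon c X (P - {g1}) (v 0) w \<or> rcon c X (P - {g2}) (v (Suc N)) w"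
  obtains c' Y where "rainbow_on c' (X \<union> v ` {1..N}) (P \<union> Y)" "finite Y" "card Y = N div 2"
    "Y \<inter> P = {}" "\<And>e. e \<subseteq> X \<Longrightarrow> c' e = c e"
    "\<And>x g. x \<in> v ` {1..N} \<Longrightarrow> g \<in> {g1, g2} \<Longrightarrow>
      \<exists>e\<in>{v 0, v (Suc N)}. rcon c' (X \<union> v ` {1..N}) (insert g Y) x e"
proof -
  define h where "h = N div 2"
  define d where "d = h + 2"
  define \<mu> where "\<mu> i = (if i = h then g1 else g2)" for i
  have hd: "Suc N = h + d" "h \<le> d" "d \<le> h + 2" unfolding h_def d_def using ear by presburger+
  have r: "{h..<d} = {h, Suc h}" unfolding d_def by auto
  obtain c' y where pe: "patterned_ear V E X v N h d c' y \<mu> P"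
    and c': "\<And>e. e \<subseteq> X \<Longrightarrow> c' e = c e"
    using pattern_exists[OF ear(1) hd, of \<mu> P c] P unfolding r by (auto simp: \<mu>_def)
  interpret pe: patterned_ear V E X v N h d c' y \<mu> P by fact
  have tr: "rcon c' pe.W A u w" if "rcon c X A u w" for A u w
    by (rule rcon_transfer[OF that]) (use c' in auto)
  have X: "rcon c' pe.W P u w" if "u \<in> X" "w \<in> X" for u w
    using tr rainbow_onD[OF rb that] by blast
  let ?Y = "y ` {..<h}"
  have m0: "rcon c' pe.W (insert g1 ?Y) (v (Suc h)) (v 0)"
    by (intro rcon_sym[OF pe.low_segment]) (auto simp: d_def \<mu>_def)
  have m1: "rcon c' pe.W (insert g2 ?Y) (v (Suc h)) (v (Suc N))"
    by (intro pe.high_segment) (use hd in \<open>auto simp: d_def \<mu>_def\<close>)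
  have gY: "insert g ?Y \<inter> (P - {g}) = {}" for g using pe.yP_empty by blast
  have mid: "rcon c' pe.W (P \<union> ?Y) (v i) w" if hi: "h < i" "i < d" "w \<in> X" for i w
  proof -
    have i: "i = Suc h" using hi d_def by auto
    consider "rcon c X (P - {g1}) (v 0) w" | "rcon c X (P - {g2}) (v (Suc N)) w"
      using cover[OF hi(3)] by blast
    then show ?thesis
    proof cases
      case 1
      have "rcon c' pe.W (insert g1 ?Y \<union> (P - {g1})) (v i) w"
        unfolding i by (rule rcon_trans[OF m0 tr[OF 1] gY])
      then show ?thesis by (rule rcon_mono) (use P in auto)
    next
      case 2
      have "rcon c' pe.W (insert g2 ?Y \<union> (P - {g2})) (v i) w"
        unfolding i by (rule rcon_trans[OF m1 tr[OF 2] gY])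
      then show ?thesis by (rule rcon_mono) (use P in auto)
    qed
  qed
  show ?thesis
  proof (rule that[of c' ?Y])
    show "rainbow_on c' pe.W (P \<union> ?Y)"
      using pe.all_pairs[OF X] mid unfolding rainbow_on_def pe.newP_def by blast
    show "card ?Y = N div 2"
      using card_image[OF inj_on_subset[OF pe.inj_y], of "{..<h}"] by (simp add: h_def)
    fix x g assume "x \<in> v ` {1..N}" and g: "g \<in> {g1, g2}"
    then obtain i where i: "x = v i" "1 \<le> i" "i \<le> N" by auto
    consider "i \<le> h" | "d \<le> i" | "i = Suc h" unfolding d_def by linarith
    then show "\<exists>e\<in>{v 0, v (Suc N)}. rcon c' pe.W (insert g ?Y) x e"
    proof cases
      case 1
      then have "rcon c' pe.W (insert g ?Y) x (v 0)" unfolding i by (intro pe.left_out) auto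
      then show ?thesis by blast
    next
      case 2
      then have "rcon c' pe.W (insert g ?Y) x (v (Suc N))"
        unfolding i using i by (intro pe.right_out) auto
      then show ?thesis by blast
    next
      case 3 then show ?thesis using m0 m1 g i by auto
    qed
  qed (use c' pe.yP_empty in auto)
qed

text \<open>Two ears attached in succession, the second one odd and touching the first: together they cost
  only about half a colour per new vertex, because the second ear needs no new colour for its middle
  vertex. Positions not covered here are reduced to these by reversing the ears.\<close>

lemma rainbow_two_ears_positioned:
  assumes rb: "rainbow_on c X P" and P: "finite P" "P \<noteq> {}" "odd N \<or> 2 \<le> card P"
    and ear: "ear X v N" and rear: "ear (X \<union> v ` {1..N}) r M" "odd M"
    and h: "h = Suc N div 2" and d: "d = Suc N - h"
    and pos: "(\<exists>i. r 0 = v i \<and> 1 \<le> i \<and> i \<le> d \<and>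
        (r (Suc M) \<in> X \<or> (\<exists>j. r (Suc M) = v j \<and> d < j \<and> j \<le> N))) \<or>
      (\<exists>i j. r 0 = v i \<and> r (Suc M) = v j \<and> i < j \<and> j \<le> h)"
  shows "\<exists>c' P'. rainbow_on c' (X \<union> v ` {1..N} \<union> r ` {1..M}) P' \<and> finite P' \<and>
    card P' = card P + Suc N div 2 + M div 2"
proof -
  have hd: "Suc N = h + d" "h \<le> d" "d \<le> h + 1" unfolding h d by auto
  \<comment> \<open>\<open>p\<close> colours the middle edge of the first ear, if there is one, and
    \<open>g\<close> must differ from it. This takes two old colours for even \<open>N\<close>; for
    odd \<open>N\<close> one colour may play both parts.\<close>
  obtain p g where pg: "p \<in> P" "g \<in> P" "d \<noteq> h \<Longrightarrow> p \<noteq> g"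
  proof (cases "even N")
    case True
    then obtain p where p: "p \<in> P" "P \<noteq> {p}" using P by fastforce
    then obtain g where "g \<in> P" "p \<noteq> g" by blast
    then show ?thesis using that p by blast
  next
    case False
    then have "d = h" unfolding h d by presburger
    then show ?thesis using that P by blast
  qed
  have inj: "inj_on (\<lambda>_. p) {h..<d}" using hd by (auto simp: inj_on_def)
  obtain c1 y where pe: "patterned_ear V E X v N h d c1 y (\<lambda>_. p) P"
    and c1: "\<And>e. e \<subseteq> X \<Longrightarrow> c1 e = c e"
    using pattern_exists[OF ear hd(1,2) _ inj, of P c] pg P hd by auto
  interpret pe: patterned_ear V E X v N h d c1 y "\<lambda>_. p" P by fact
  have X: "rcon c1 pe.W P u w" if "u \<in> X" "w \<in> X" for u w
    by (rule rcon_transfer[OF rainbow_onD[OF rb that]]) (use c1 in auto)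
  have rb1: "rainbow_on c1 pe.W pe.newP"
    using pe.all_pairs[OF X] hd unfolding rainbow_on_def by auto
  have fin: "finite pe.newP" unfolding pe.newP_def using P by auto
  have card: "card pe.newP = card P + Suc N div 2"
    unfolding pe.newP_def
    using card_image[OF inj_on_subset[OF pe.inj_y], of "{..<h}"] P pe.yP_empty h
    by (subst card_Un_disjoint) auto
  have gmu: "g \<notin> (\<lambda>_. p) ` {h..<d}" using pg hd by auto
  have "0 < N" using ear by (auto simp: ear_def)
  then have "0 < h" unfolding h by auto
  have new: "g \<in> pe.newP" "y k \<noteq> g" "g \<noteq> y k" "k < h \<Longrightarrow> y k \<in> pe.newP" for k
    using pg pe.y_P by (auto simp: pe.newP_def)
  \<comment> \<open>The two middle edges of the second ear receive \<open>g\<close> and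
    \<open>y 0\<close> in the situation of \<open>cover_low\<close>, and \<open>y i\<close> and
    \<open>g\<close> in that of \<open>cover_left\<close>.\<close>
  have "\<exists>g1 g2. g1 \<in> pe.newP \<and> g2 \<in> pe.newP \<and> g1 \<noteq> g2 \<and>
    (\<forall>w\<in>pe.W. rcon c1 pe.W (pe.newP - {g1}) (r 0) w \<or>
      rcon c1 pe.W (pe.newP - {g2}) (r (Suc M)) w)"
    using pos
  proof (elim disjE exE conjE)
    fix i assume i: "r 0 = v i" "1 \<le> i" "i \<le> d"
      and e: "r (Suc M) \<in> X"
    then have e': "r (Suc M) \<in> X \<or> (\<exists>j. r (Suc M) = v j \<and> d < j \<and> j \<le> N)" by blast
    show ?thesis
      unfolding i(1)
      by (intro exI[of _ g] exI[of _ "y 0"] conjI ballI new(1) new(3) new(4)[OF \<open>0 < h\<close>]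
          pe.cover_low[OF X hd(3) pg(2) gmu i(2,3) e'])
  next
    fix i j assume i: "r 0 = v i" "1 \<le> i" "i \<le> d"
      and e: "r (Suc M) = v j" "d < j" "j \<le> N"
    then have e': "r (Suc M) \<in> X \<or> (\<exists>j. r (Suc M) = v j \<and> d < j \<and> j \<le> N)" by blast
    show ?thesis
      unfolding i(1)
      by (intro exI[of _ g] exI[of _ "y 0"] conjI ballI new(1) new(3) new(4)[OF \<open>0 < h\<close>]
          pe.cover_low[OF X hd(3) pg(2) gmu i(2,3) e'])
  next
    fix i j assume ij: "r 0 = v i" "r (Suc M) = v j" "i < j" "j \<le> h"
    have "i < h" using ij by simp
    show ?thesis
      unfolding ij(1,2)
      by (intro exI[of _ "y i"] exI[of _ g] conjI ballI new(1) new(2) new(4)[OF \<open>i < h\<close>]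
          pe.cover_left[OF X hd(3) pg(2) gmu ij(3,4)])
  qed
  then obtain g1 g2 where g12: "g1 \<in> pe.newP" "g2 \<in> pe.newP" "g1 \<noteq> g2"
    and cov: "\<And>w. w \<in> pe.W \<Longrightarrow> rcon c1 pe.W (pe.newP - {g1}) (r 0) w \<or>
      rcon c1 pe.W (pe.newP - {g2}) (r (Suc M)) w" by blast
  obtain c2 Y where "rainbow_on c2 (pe.W \<union> r ` {1..M}) (pe.newP \<union> Y)" "finite Y"
    "card Y = M div 2" "Y \<inter> pe.newP = {}"
    using extend_odd_ear[OF rb1 fin g12 rear cov] by metis
  then show ?thesis using fin card
    by (intro exI[of _ c2] exI[of _ "pe.newP \<union> Y"])
      (auto simp: card_Un_disjoint Int_commute)
qed

text \<open>\<open>mid\<close> excludes a second ear that joins the ends of the middle edge of an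
  even first ear: its ends sit at \<open>h\<close> and \<open>h + 1 = d\<close>, which matches
  neither admissible position in either orientation.\<close>

lemma rainbow_two_ears:
  assumes rb: "rainbow_on c X P" and P: "finite P" "P \<noteq> {}" "odd N \<or> 2 \<le> card P"
    and ear: "ear X v N" and rear: "ear (X \<union> v ` {1..N}) r M" "odd M"
    and touch: "\<not> (r 0 \<in> X \<and> r (Suc M) \<in> X)"
    and mid: "even N \<Longrightarrow> {r 0, r (Suc M)} \<noteq> {v (N div 2), v (Suc (N div 2))}"
  shows "\<exists>c' P'. rainbow_on c' (X \<union> v ` {1..N} \<union> r ` {1..M}) P' \<and> finite P' \<and>
    card P' = card P + Suc N div 2 + M div 2"
proof -
  define h where "h = Suc N div 2"
  define d where "d = Suc N - h"
  have hd: "Suc N = h + d" "h \<le> d" "d \<le> h + 1" unfolding h_def d_def by auto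
  let ?v = "\<lambda>i. v (Suc N - i)"
  note core = rainbow_two_ears_positioned[OF rb P ear _ _ h_def d_def]
  note core_rev = rainbow_two_ears_positioned[OF rb P ear_rev[OF ear] _ _ h_def d_def,
      unfolded ear_rev_image]
  have main: "\<exists>c' P'. rainbow_on c' (X \<union> v ` {1..N} \<union> r ` {1..M}) P' \<and> finite P' \<and>
    card P' = card P + Suc N div 2 + M div 2"
    if r: "ear (X \<union> v ` {1..N}) r M" and i: "r 0 = v i" "1 \<le> i" "i \<le> N"
      and e: "r (Suc M) \<in> X \<or> (\<exists>j. r (Suc M) = v j \<and> i < j \<and> j \<le> N)"
      and mid: "even N \<Longrightarrow> {r 0, r (Suc M)} \<noteq> {v (N div 2), v (Suc (N div 2))}"
    for r i
  proof (cases "r (Suc M) \<in> X")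
    case True
    show ?thesis
    proof (cases "i \<le> d")
      case le: True
      show ?thesis by (rule core[OF r rear(2)]) (use True le i in blast)
    next
      case False
      have "r 0 = ?v (Suc N - i)" using i by auto
      moreover have "1 \<le> Suc N - i" "Suc N - i \<le> d" using i False hd by auto
      ultimately show ?thesis by (intro core_rev[OF r rear(2)]) (use True in blast)
    qed
  next
    case False
    then obtain j where j: "r (Suc M) = v j" "i < j" "j \<le> N" using e by blast
    let ?r = "\<lambda>i. r (Suc M - i)"
    have rr: "ear (X \<union> v ` {1..N}) ?r M" by (rule ear_rev[OF r])
    note rev = core_rev[OF rr rear(2), unfolded ear_rev_image]
    have r0: "?r 0 = ?v (Suc N - j)" and r1: "?r (Suc M) = ?v (Suc N - i)" using i j by auto
    have "\<not> (j = Suc h \<and> d = Suc h \<and> i = h)"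
    proof
      assume a: "j = Suc h \<and> d = Suc h \<and> i = h"
      then have "N = 2 * h" using hd by auto
      then show False using a mid i j by auto
    qed
    \<comment> \<open>The first two cases fit as they stand; in the last two both ears are
      reversed.\<close>
    then consider "i \<le> d" "d < j" | "j \<le> h" | "i < h" "h \<le> j" | "d \<le> i"
      using hd \<open>i < j\<close> by linarith
    then show ?thesis
    proof cases
      case 1 then show ?thesis by (intro core[OF r rear(2)]) (use i j in blast)
    next
      case 2 then show ?thesis by (intro core[OF r rear(2)]) (use i j in blast)
    next
      case 3
      then have "1 \<le> Suc N - j" "Suc N - j \<le> d" "d < Suc N - i" "Suc N - i \<le> N"
        using i j hd by auto
      then show ?thesis using r0 r1 by (intro rev) blast
    next
      case 4
      then have "Suc N - j < Suc N - i" "Suc N - i \<le> h" using i j hd by auto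
      then show ?thesis using r0 r1 by (intro rev) blast
    qed
  qed
  let ?r = "\<lambda>i. r (Suc M - i)"
  have rr: "ear (X \<union> v ` {1..N}) ?r M" by (rule ear_rev[OF rear(1)])
  note main_rev = main[OF rr, unfolded ear_rev_image, simplified]
  have ends: "r 0 \<in> X \<union> v ` {1..N}" "r (Suc M) \<in> X \<union> v ` {1..N}" "r 0 \<noteq> r (Suc M)"
    using rear by (auto simp: ear_def)
  have mid': "even N \<Longrightarrow> {r (Suc M), r 0} \<noteq> {v (N div 2), v (Suc (N div 2))}"
    using mid by (simp add: insert_commute)
  show ?thesis
  proof (cases "r 0 \<in> X")
    case True
    then obtain j where "r (Suc M) = v j" "1 \<le> j" "j \<le> N" using ends touch by auto
    then show ?thesis using main_rev[of j] True mid' by simp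
  next
    case False
    then obtain i where i: "r 0 = v i" "1 \<le> i" "i \<le> N" using ends by auto
    show ?thesis
    proof (cases "r (Suc M) \<in> X")
      case True then show ?thesis using main[OF rear(1) i] mid by blast
    next
      case False
      then obtain j where j: "r (Suc M) = v j" "1 \<le> j" "j \<le> N" using ends by auto
      consider "i < j" | "j < i" using ends i j by (metis nat_neq_iff)
      then show ?thesis
      proof cases
        case 1 then show ?thesis using main[OF rear(1) i] j mid by blast
      next
        case 2 then show ?thesis using main_rev[of j] i j mid' by auto
      qed
    qed
  qed
qed

end

section \<open>Ears supplied by 2-connectivity\<close>

lemma successively_crossing:
  assumes "successively R p" "p \<noteq> []" "hd p \<in> A" "last p \<notin> A"
  shows "\<exists>a b. R a b \<and> a \<in> A \<and> b \<notin> A \<and> a \<in> set p \<and> b \<in> set p"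
  using assms
proof (induction p rule: induct_list012)
  case (3 x y zs)
  show ?case
  proof (cases "y \<in> A")
    case True
    then show ?thesis using 3 by auto
  next
    case False
    then show ?thesis using 3 by auto
  qed
qed auto

context two_connected
begin

lemma finite_V: "finite V"
  using simple by (simp add: simple_graph_def)

lemma edge_in_V: "{x, y} \<in> E \<Longrightarrow> x \<in> V \<and> y \<in> V"
  using simple by (auto simp: simple_graph_def)

lemma no_small_cut:
  assumes "disconnecting_set V E A"
  shows "2 \<le> card A"
proof -
  have "vertex_connectivity V E \<le> card A"
    unfolding vertex_connectivity_def using assms by (intro Least_le) blast
  then show ?thesis using two_conn unfolding vertex_connected_def by simp
qed

lemma connected_V: "connected_graph V E" "1 < card V"
proof -
  have "\<not> disconnecting_set V E {}" using no_small_cut[of "{}"] by auto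
  then show "connected_graph V E" "1 < card V"
    by (simp_all add: disconnecting_set_def remove_vertices_edges_def)
qed

lemma connected_minus: "x \<in> V \<Longrightarrow> connected_graph (V - {x}) {e \<in> E. x \<notin> e}"
  using no_small_cut[of "{x}"] by (auto simp: disconnecting_set_def remove_vertices_edges_def)

lemma boundary_edge:
  assumes "X \<subseteq> V" "X \<noteq> {}" "X \<noteq> V"
  obtains x y where "x \<in> X" "y \<in> V - X" "{x, y} \<in> E"
proof -
  obtain a b where "a \<in> X" "b \<in> V - X" using assms by blast
  then obtain p where p: "path_joins V E a p b"
    using connected_V assms unfolding connected_graph_def by blast
  then show ?thesis
    using successively_crossing[of "\<lambda>u v. {u, v} \<in> E" p X] that \<open>a \<in> X\<close> \<open>b \<in> V - X\<close>
    unfolding path_joins_def is_path_def by blast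
qed

text \<open>After the edge from \<open>x\<close> to \<open>y\<close>, the ear follows a path from
  \<open>y\<close> to \<open>x'\<close> in \<open>G - x\<close> up to its first vertex in
  \<open>X\<close>. Avoiding \<open>x\<close> makes the two ends distinct.\<close>

lemma ear_exists:
  assumes X: "X \<subseteq> V" "x \<in> X" "x' \<in> X" "x' \<noteq> x" and y: "y \<in> V - X" "{x, y} \<in> E"
  obtains v N where "ear X v N" "v 0 = x"
proof -
  have "x \<in> V" "y \<in> V - {x}" "x' \<in> V - {x}" using assms by auto
  then obtain p where p: "path_joins (V - {x}) {e \<in> E. x \<notin> e} y p x'"
    using connected_minus unfolding connected_graph_def by blast
  then have ip: "p \<noteq> []" "set p \<subseteq> V - {x}" "distinct p" "hd p = y" "last p = x'"
    "successively (\<lambda>u v. {u, v} \<in> E) p"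
    unfolding path_joins_def is_path_def by (auto elim: successively_mono)
  have "\<exists>z\<in>set p. z \<in> X" using ip X last_in_set by metis
  then obtain pre z post where s: "p = pre @ z # post" "z \<in> X" "\<forall>u\<in>set pre. u \<notin> X"
    using split_list_first_prop[of p "\<lambda>z. z \<in> X"] by blast
  define q where "q = x # pre @ [z]"
  have ne: "pre \<noteq> []" using s ip y by auto
  have sq: "successively (\<lambda>u v. {u, v} \<in> E) q"
    using ip y ne unfolding q_def s(1) by (auto simp: successively_append_iff successively_Cons)
  have lenq: "length q = length pre + 2" by (simp add: q_def)
  have mid: "q ! i = pre ! (i - 1)" if "1 \<le> i" "i \<le> length pre" for i
    using that by (auto simp: q_def nth_Cons' nth_append)
  have im: "(!) q ` {1..length pre} = set pre"
  proof -
    have "set pre = (!) pre ` {..<length pre}" by (auto simp: set_conv_nth)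
    also have "{..<length pre} = (\<lambda>i. i - 1) ` {1..length pre}"
      by (auto simp: image_iff) (metis Suc_le_eq Suc_le_mono diff_Suc_1 le0 One_nat_def atLeastAtMost_iff)
    finally show ?thesis using mid by (auto simp: image_iff)
  qed
  have "ear X ((!) q) (length pre)"
    unfolding ear_def
  proof (intro conjI allI impI)
    show "0 < length pre" using ne by simp
    show "q ! 0 \<in> X" using X by (simp add: q_def)
    show "q ! Suc (length pre) \<in> X" using s by (simp add: q_def nth_append)
    show "q ! 0 \<noteq> q ! Suc (length pre)" using s ip by (auto simp: q_def nth_append)
    show "inj_on ((!) q) {1..length pre}"
    proof (rule inj_onI)
      fix i j assume ij: "i \<in> {1..length pre}" "j \<in> {1..length pre}" "q ! i = q ! j"
      then have "pre ! (i - 1) = pre ! (j - 1)" using mid by auto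
      moreover have "distinct pre" using ip s by auto
      ultimately have "i - 1 = j - 1" using ij by (subst (asm) nth_eq_iff_index_eq) auto
      then show "i = j" using ij by auto
    qed
    show "(!) q ` {1..length pre} \<subseteq> V - X" unfolding im using s ip by auto
    fix i assume "i \<le> length pre"
    then show "{q ! i, q ! Suc i} \<in> E"
      using sq lenq by (auto simp: successively_conv_nth)
  qed
  then show ?thesis using that[of "(!) q"] by (simp add: q_def)
qed

lemma ear_subset:
  assumes "ear X v N" "Y \<subseteq> X" "v 0 \<in> Y" "v (Suc N) \<in> Y"
  shows "ear Y v N"
  using assms unfolding ear_def by auto

lemma ear_card:
  assumes "ear X v N" "finite X"
  shows "card (X \<union> v ` {1..N}) = card X + N"
proof -
  have "card (v ` {1..N}) = N" using assms by (simp add: ear_def card_image)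
  moreover have "X \<inter> v ` {1..N} = {}" using assms unfolding ear_def by blast
  ultimately show ?thesis using assms by (simp add: card_Un_disjoint)
qed

text \<open>The edge between \<open>v h\<close> and \<open>v (Suc h)\<close> is replaced by the ear
  \<open>r\<close>. With \<open>N\<close> even and \<open>M\<close> odd this yields an odd ear, as
  exploited in \<open>tame_step\<close>.\<close>

lemma ear_splice:
  assumes v: "ear X v N" and r: "ear (X \<union> v ` {1..N}) r M"
    and h: "1 \<le> h" "h < N" "r 0 = v h" "r (Suc M) = v (Suc h)"
  shows "ear X (\<lambda>i. if i \<le> h then v i else if i \<le> h + M then r (i - h) else v (i - M)) (N + M)"
    (is "ear X ?w _")
proof -
  have ev: "{v i, v (Suc i)} \<in> E" if "i \<le> N" for i using v that unfolding ear_def by blast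
  have er: "{r i, r (Suc i)} \<in> E" if "i \<le> M" for i using r that unfolding ear_def by blast
  have mv: "v i \<in> V - X" if "1 \<le> i" "i \<le> N" for i
    using v that unfolding ear_def image_subset_iff by auto
  have mr: "r i \<in> V - (X \<union> v ` {1..N})" if "1 \<le> i" "i \<le> M" for i
    using r that unfolding ear_def image_subset_iff[of r] by auto
  have rv: "r i \<noteq> v j" if "1 \<le> i" "i \<le> M" "1 \<le> j" "j \<le> N" for i j
    using mr[of i] that by auto
  have iv: "i = j" if "v i = v j" "1 \<le> i" "i \<le> N" "1 \<le> j" "j \<le> N" for i j
    using inj_onD[OF ear_inj[OF v] that(1)] that by simp
  have ir: "i = j" if "r i = r j" "1 \<le> i" "i \<le> M" "1 \<le> j" "j \<le> M" for i j
    using inj_onD[OF ear_inj[OF r] that(1)] that by simp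
  have "M > 0" using r by (simp add: ear_def)
  show ?thesis
    unfolding ear_def
  proof (intro conjI allI impI)
    show "0 < N + M" using h by simp
    show "?w 0 \<in> X" "?w (Suc (N + M)) \<in> X" "?w 0 \<noteq> ?w (Suc (N + M))"
      using v h by (auto simp: ear_def)
    show "inj_on ?w {1..N + M}"
    proof (rule linorder_inj_onI)
      fix i j assume ij: "i < j" "i \<in> {1..N + M}" "j \<in> {1..N + M}"
      consider "j \<le> h" | "i \<le> h" "h < j" "j \<le> h + M" | "i \<le> h" "h + M < j"
        | "h < i" "j \<le> h + M" | "h < i" "i \<le> h + M" "h + M < j" | "h + M < i"
        using ij by linarith
      then show "?w i \<noteq> ?w j"
      proof cases
        case 1 then show ?thesis using iv[of i j] ij h by auto
      next
        case 2 then show ?thesis using rv[of "j - h" i, THEN not_sym] ij h by auto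
      next
        case 3 then show ?thesis using iv[of i "j - M"] ij h by auto
      next
        case 4
        then have "1 \<le> i - h" "i - h \<le> M" "1 \<le> j - h" "j - h \<le> M" "i - h \<noteq> j - h"
          using ij by auto
        then show ?thesis using ir[of "i - h" "j - h"] 4 ij by auto
      next
        case 5 then show ?thesis using rv[of "i - h" "j - M"] ij h by auto
      next
        case 6
        then have "1 \<le> i - M" "i - M \<le> N" "1 \<le> j - M" "j - M \<le> N" "i - M \<noteq> j - M"
          using ij by auto
        then show ?thesis using iv[of "i - M" "j - M"] 6 ij by auto
      qed
    qed auto
    show "?w ` {1..N + M} \<subseteq> V - X"
    proof
      fix x assume "x \<in> ?w ` {1..N + M}"
      then obtain i where "i \<in> {1..N + M}" and x: "x = ?w i" by (rule imageE)
      then have "1 \<le> i" "i \<le> N + M" by simp_all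
      then show "x \<in> V - X"
        using x h mv[of i] mr[of "i - h"] mv[of "i - M"] by (auto split: if_splits)
    qed
    fix i assume i: "i \<le> N + M"
    consider "i < h" | "i = h" | "h < i" "i < h + M" | "i = h + M" | "h + M < i" by linarith
    then show "{?w i, ?w (Suc i)} \<in> E"
    proof cases
      case 1 then show ?thesis using ev[of i] h by auto
    next
      case 2 then show ?thesis using er[of 0] h \<open>M > 0\<close> by auto
    next
      case 3 then show ?thesis using er[of "i - h"] h by (auto simp: Suc_diff_le)
    next
      case 4 then show ?thesis using er[of M] h \<open>M > 0\<close> by auto
    next
      case 5 then show ?thesis using ev[of "i - M"] h i by (auto simp: Suc_diff_le)
    qed
  qed
qed

subsection \<open>Maximal sets coloured with half as many colours as vertices\<close>

text \<open>\<open>P\<close> is the palette of the connecting walks only; other edges may have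
  colours outside it.\<close>

definition rich :: "'a set \<Rightarrow> bool" where
  "rich W \<longleftrightarrow> W \<subseteq> V \<and> (\<exists>c P. rainbow_on c W P \<and> finite P \<and> P \<noteq> {} \<and> 2 * card P \<le> card W)"

lemma rich_exists: "\<exists>W. rich W"
proof -
  obtain a where a: "a \<in> V" using connected_V by fastforce
  moreover have "{a} \<noteq> V" using connected_V by auto
  ultimately obtain b where b: "b \<in> V - {a}" "{a, b} \<in> E"
    using boundary_edge[of "{a}"] by auto
  have "rcon (\<lambda>_. 0) {a, b} {0} a b" using b by (intro rcon_edge) auto
  then have "rainbow_on (\<lambda>_. 0) {a, b} {0}"
    using rcon_sym by (auto simp: rainbow_on_def intro: rcon_refl)
  then have "rich {a, b}" using a b unfolding rich_def by fastforce
  then show ?thesis ..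
qed

text \<open>\<open>rc\<close> counts the colours on all of \<open>E\<close>. Edges coloured outside
  \<open>Q\<close> lie on none of the chosen rainbow paths, so they can be given a single colour
  \<open>q\<close> of \<open>Q\<close>.\<close>

lemma rc_le:
  assumes "rainbow_on c V Q" "finite Q" "Q \<noteq> {}"
  shows "rc V E \<le> card Q"
proof -
  obtain q where "q \<in> Q" using assms by blast
  define c' where "c' e = (if c e \<in> Q then c e else q)" for e
  have "rainbow_colouring V E c'"
    unfolding rainbow_colouring_def
  proof (intro ballI)
    fix u w assume "u \<in> V" "w \<in> V"
    then obtain p where p: "path_joins V E u p w" "rainbow_path c p" "c ` set (path_edges p) \<subseteq> Q"
      using rcon_path rainbow_onD[OF assms(1)] by metis
    have "map c' (path_edges p) = map c (path_edges p)" using p(3) by (auto simp: c'_def)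
    then show "\<exists>p. path_joins V E u p w \<and> rainbow_path c' p"
      using p unfolding rainbow_path_def by metis
  qed
  then have "rc V E \<le> card (c' ` E)" unfolding rc_def by (intro Least_le) blast
  also have "\<dots> \<le> card Q" using assms \<open>q \<in> Q\<close> by (intro card_mono) (auto simp: c'_def)
  finally show ?thesis .
qed

end

section \<open>Ears around a maximal rich set\<close>

locale saturated = two_connected V E for V :: "'a set" and E +
  fixes S :: "'a set" and cS :: "'a set \<Rightarrow> nat" and PS :: "nat set" and z1 z2 :: nat
  assumes SV: "S \<subseteq> V" and S_rb: "rainbow_on cS S PS" and PS: "finite PS" "PS \<noteq> {}"
    and S_card: "2 * card PS \<le> card S"
    and S_max: "\<And>W. rich W \<Longrightarrow> S \<subset> W \<Longrightarrow> False"
    and z: "z1 \<noteq> z2" "z1 \<notin> PS" "z2 \<notin> PS"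
begin

lemma fin: "W \<subseteq> V \<Longrightarrow> finite W"
  using finite_V finite_subset by blast

lemma card_PS: "1 \<le> card PS"
  using PS by (simp add: Suc_le_eq card_gt_0_iff)

lemma ear_psubset: "ear X v N \<Longrightarrow> X \<subset> X \<union> v ` {1..N}"
  unfolding ear_def by fastforce

text \<open>An even ear brings \<open>N\<close> vertices for \<open>N div 2\<close> colours, so
  adding it to \<open>S\<close> would give a larger rich set.\<close>

lemma ear_S_odd:
  assumes "ear S v N"
  shows "odd N"
proof
  assume "even N"
  obtain c Y where "rainbow_on c (S \<union> v ` {1..N}) (PS \<union> Y)" "finite Y" "card Y = Suc N div 2"
    "Y \<inter> PS = {}"
    using extend_ear[OF S_rb PS assms] by metis
  moreover have "S \<union> v ` {1..N} \<subseteq> V" using assms SV unfolding ear_def by blast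
  moreover have "2 * card (PS \<union> Y) \<le> card (S \<union> v ` {1..N})"
    using calculation PS S_card \<open>even N\<close> ear_card[OF assms fin[OF SV]]
    by (subst card_Un_disjoint) auto
  ultimately have "rich (S \<union> v ` {1..N})" unfolding rich_def using PS
    by (intro conjI exI[of _ c] exI[of _ "PS \<union> Y"]) auto
  then show False using S_max ear_psubset[OF assms] by blast
qed

text \<open>\<open>T\<close> arises from \<open>S\<close> by one odd ear followed by even ears. The clause on odd ears of \<open>T\<close> survives
  even ears because an odd ear violating it would, by the saving above, produce a rich set larger
  than \<open>S\<close>.\<close>

definition tame :: "'a set \<Rightarrow> bool" where
  "tame T \<longleftrightarrow> S \<subset> T \<and> T \<subseteq> V \<and>
    (\<exists>c P. rainbow_on c T P \<and> finite P \<and> 2 \<le> card P \<and> 2 * card P \<le> card T + 1) \<and>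
    (\<forall>r M. ear T r M \<longrightarrow> odd M \<longrightarrow> r 0 \<in> S \<and> r (Suc M) \<in> S)"

text \<open>Twice the colours added is \<open>N + M\<close> for odd \<open>N\<close> and
  \<open>N + M - 1\<close> for even \<open>N\<close>. The latter pays back the excess of 1 allowed
  in \<open>count\<close>, so the union is rich in both cases.\<close>

lemma two_ears_contradiction:
  assumes T: "S \<subseteq> T" "T \<subseteq> V" and rb: "rainbow_on c T P"
    and P: "finite P" "P \<noteq> {}" "odd N \<or> 2 \<le> card P"
    and count: "2 * card P \<le> card T + (if odd N then 0 else 1)"
    and ear: "ear T v N" and rear: "ear (T \<union> v ` {1..N}) r M" "odd M"
    and touch: "\<not> (r 0 \<in> T \<and> r (Suc M) \<in> T)"
    and mid: "even N \<Longrightarrow> {r 0, r (Suc M)} \<noteq> {v (N div 2), v (Suc (N div 2))}"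
  shows False
proof -
  let ?W = "T \<union> v ` {1..N} \<union> r ` {1..M}"
  obtain c' P' where c': "rainbow_on c' ?W P'" "finite P'"
    "card P' = card P + Suc N div 2 + M div 2"
    using rainbow_two_ears[OF rb P ear rear touch mid] by metis
  have "v ` {1..N} \<subseteq> V" using ear unfolding ear_def by blast
  then have TV: "T \<union> v ` {1..N} \<subseteq> V" using T by blast
  then have card: "card ?W = card T + N + M"
    using ear_card[OF ear] ear_card[OF rear(1)] fin T by simp
  have "2 * (Suc N div 2) = (if odd N then N + 1 else N)" "2 * (M div 2) + 1 = M"
    using rear(2) by auto
  then have "2 * card P' \<le> card ?W" using count card c'(3) by (auto split: if_splits)
  moreover have "P' \<noteq> {}"
  proof -
    have "0 < card P" using P by (simp add: card_gt_0_iff)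
    then show ?thesis using c'(3) by auto
  qed
  moreover have "r ` {1..M} \<subseteq> V" using rear(1) unfolding ear_def by blast
  then have "?W \<subseteq> V" using TV by blast
  ultimately have "rich ?W" unfolding rich_def using c' by blast
  moreover have "S \<subset> ?W" using T ear_psubset[OF ear] by blast
  ultimately show False using S_max by blast
qed

lemma tame_base:
  assumes ear: "ear S v N"
  shows "tame (S \<union> v ` {1..N})"
proof -
  let ?T = "S \<union> v ` {1..N}"
  have odd: "odd N" using ear_S_odd[OF ear] .
  obtain c Y where c: "rainbow_on c ?T (PS \<union> Y)" "finite Y" "card Y = Suc N div 2"
    "Y \<inter> PS = {}"
    using extend_ear[OF S_rb PS ear] by metis
  have card: "card (PS \<union> Y) = card PS + Suc N div 2"
    using c PS by (subst card_Un_disjoint) auto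
  have N: "2 * (Suc N div 2) = N + 1" "1 \<le> Suc N div 2" using odd by (auto elim: oddE)
  have TV: "?T \<subseteq> V" using ear SV unfolding ear_def by blast
  have "r 0 \<in> S \<and> r (Suc M) \<in> S" if "ear ?T r M" "odd M" for r M
    using two_ears_contradiction[OF order_refl SV S_rb PS _ _ ear that] odd S_card by auto
  moreover have "2 * card (PS \<union> Y) \<le> card ?T + 1" "2 \<le> card (PS \<union> Y)"
    using card N S_card card_PS ear_card[OF ear fin[OF SV]] by auto
  ultimately show ?thesis
    unfolding tame_def using ear_psubset[OF ear] TV c PS by blast
qed

text \<open>An odd ear of the new set either is an odd ear of \<open>T\<close>, or touches the
  interior of the even ear just added. The latter contradicts the maximality of \<open>S\<close>,
  with one configuration treated separately.\<close>

lemma tame_step: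
  assumes T: "tame T" and ear: "ear T v N" and even: "even N"
  shows "tame (T \<union> v ` {1..N})"
proof -
  let ?T = "T \<union> v ` {1..N}"
  obtain c P where c: "rainbow_on c T P" "finite P" "2 \<le> card P" "2 * card P \<le> card T + 1"
    and TS: "S \<subset> T" "T \<subseteq> V"
    and nodd: "\<And>r M. ear T r M \<Longrightarrow> odd M \<Longrightarrow> r 0 \<in> S \<and> r (Suc M) \<in> S"
    using T unfolding tame_def by blast
  have P: "P \<noteq> {}" using c by auto
  obtain c' Y where c': "rainbow_on c' ?T (P \<union> Y)" "finite Y" "card Y = Suc N div 2"
    "Y \<inter> P = {}"
    using extend_ear[OF c(1,2) P ear] by metis
  have card: "card (P \<union> Y) = card P + N div 2"
    using c c' even by (subst card_Un_disjoint) auto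
  have TV: "?T \<subseteq> V" using ear TS unfolding ear_def by blast
  \<comment> \<open>The exceptional position at the middle edge: splicing gives an odd ear of
    \<open>T\<close>, whose ends \<open>v 0\<close> and \<open>v (Suc N)\<close> lie in
    \<open>S\<close> by tameness. Then \<open>v\<close> itself would be an even ear of
    \<open>S\<close>.\<close>
  have nadj: False if r: "ear ?T r M" "odd M" "r 0 = v (N div 2)" "r (Suc M) = v (Suc (N div 2))" for r M
  proof -
    have N: "1 \<le> N div 2" "N div 2 < N" using ear even unfolding ear_def by auto
    let ?w = "\<lambda>i. if i \<le> N div 2 then v i else if i \<le> N div 2 + M then r (i - N div 2) else v (i - M)"
    have "ear T ?w (N + M)" by (rule ear_splice[OF ear r(1) N r(3,4)])
    moreover have "odd (N + M)" using even r(2) by simp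
    ultimately have "?w 0 \<in> S \<and> ?w (Suc (N + M)) \<in> S" by (rule nodd)
    then have "v 0 \<in> S" "v (Suc N) \<in> S" using N by auto
    then have "ear S v N" using ear_subset[OF ear] TS by blast
    then show False using ear_S_odd even by blast
  qed
  have "r 0 \<in> S \<and> r (Suc M) \<in> S" if r: "ear ?T r M" "odd M" for r M
  proof (cases "r 0 \<in> T \<and> r (Suc M) \<in> T")
    case True
    then show ?thesis using nodd ear_subset[OF r(1), of T] r(2) by blast
  next
    case False
    have "{r 0, r (Suc M)} \<noteq> {v (N div 2), v (Suc (N div 2))}"
    proof
      assume "{r 0, r (Suc M)} = {v (N div 2), v (Suc (N div 2))}"
      then consider "r 0 = v (N div 2)" "r (Suc M) = v (Suc (N div 2))"
        | "r 0 = v (Suc (N div 2))" "r (Suc M) = v (N div 2)" by (auto simp: doubleton_eq_iff)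
      then show False
      proof cases
        case 1 then show ?thesis using nadj r by blast
      next
        case 2 then show ?thesis using nadj[OF ear_rev[OF r(1)] r(2)] by simp
      qed
    qed
    then show ?thesis
      using two_ears_contradiction[OF _ TS(2) c(1,2) P _ _ ear r False] TS c even by auto
  qed
  moreover have "2 * card (P \<union> Y) \<le> card ?T + 1" "2 \<le> card (P \<union> Y)"
    using card c even ear_card[OF ear fin[OF TS(2)]] by auto
  ultimately show ?thesis
    unfolding tame_def using ear_psubset[OF ear] TS TV c c' by blast
qed

section \<open>Colouring the components with two shared colours\<close>

text \<open>Every vertex reaches \<open>S\<close> in private colours plus \<open>z1\<close>, and also in private colours plus \<open>z2\<close>.
  Hence two vertices in different components of \<open>G - S\<close> are joined through \<open>S\<close>, and \<open>z1\<close>, \<open>z2\<close> can serve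
  all components at once.\<close>

definition tethered :: "('a set \<Rightarrow> nat) \<Rightarrow> nat set \<Rightarrow> 'a set \<Rightarrow> bool" where
  "tethered c P U \<longleftrightarrow> S \<subseteq> U \<and> finite P \<and> PS \<subseteq> P \<and> z1 \<notin> P \<and> z2 \<notin> P \<and>
    rainbow_on c U (P \<union> {z1, z2}) \<and> rainbow_on c S PS \<and>
    (\<forall>u\<in>U. \<forall>g\<in>{z1, z2}. \<exists>s\<in>S. rcon c U (insert g (P - PS)) u s)"

lemma tethered_S: "tethered cS PS S"
  unfolding tethered_def using S_rb PS z
  by (auto simp: rainbow_on_def intro: rcon_refl rcon_mono)

text \<open>A new vertex either reaches \<open>U\<close> in the fresh colours \<open>Y\<close> and
  follows an old tether, whose colours are disjoint from \<open>Y\<close>, or reaches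
  \<open>S\<close> directly. The second form serves the odd ear that opens a component.\<close>

lemma tethered_extend:
  assumes teth: "tethered c P U"
    and W: "W = U \<union> A" and rb: "rainbow_on c' W (P \<union> {z1, z2} \<union> Y)"
    and Y: "finite Y" "Y \<inter> (P \<union> {z1, z2}) = {}"
    and agree: "\<And>e. e \<subseteq> U \<Longrightarrow> c' e = c e"
    and new: "\<And>x g. x \<in> A \<Longrightarrow> g \<in> {z1, z2} \<Longrightarrow>
      (\<exists>e\<in>U. rcon c' W Y x e) \<or> (\<exists>s\<in>S. rcon c' W (insert g Y) x s)"
  shows "tethered c' (P \<union> Y) W"
proof -
  have SU: "S \<subseteq> U" and PSP: "PS \<subseteq> P"
    and teth': "\<And>u g. u \<in> U \<Longrightarrow> g \<in> {z1, z2} \<Longrightarrow> \<exists>s\<in>S. rcon c U (insert g (P - PS)) u s"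
    using teth unfolding tethered_def by auto
  have "\<exists>s\<in>S. rcon c' W (insert g (P - PS)) u s" if "u \<in> U" "g \<in> {z1, z2}" for u g
    using teth'[OF that] rcon_transfer[where Y = W and c' = c'] agree W by (metis Un_upper1 order_refl)
  note old = this
  have sub: "insert g (P - PS) \<subseteq> insert g (P \<union> Y - PS)" "insert g Y \<subseteq> insert g (P \<union> Y - PS)"
    "Y \<union> insert g (P - PS) = insert g (P \<union> Y - PS)" for g
    using Y PSP by auto
  have "\<exists>s\<in>S. rcon c' W (insert g (P \<union> Y - PS)) u s" if u: "u \<in> W" and g: "g \<in> {z1, z2}" for u g
  proof (cases "u \<in> U")
    case True
    then show ?thesis using old[OF True g] rcon_mono sub(1) by blast
  next
    case False
    then consider e where "e \<in> U" "rcon c' W Y u e" | s where "s \<in> S" "rcon c' W (insert g Y) u s"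
      using new[OF _ g] u W by blast
    then show ?thesis
    proof cases
      case 1
      then obtain s where s: "s \<in> S" "rcon c' W (insert g (P - PS)) e s" using old g by blast
      have "rcon c' W (Y \<union> insert g (P - PS)) u s"
        by (rule rcon_trans[OF 1(2) s(2)]) (use Y g in auto)
      then show ?thesis using s sub(3) by auto
    next
      case 2 then show ?thesis using rcon_mono sub(2) by blast
    qed
  qed
  moreover have "rcon c' S PS u w" if "u \<in> S" "w \<in> S" for u w
    by (rule rcon_transfer[where c = c and X = S and A = PS])
      (use teth that SU agree in \<open>auto simp: tethered_def rainbow_on_def\<close>)
  then have "rainbow_on c' S PS" by (simp add: rainbow_on_def)
  moreover have "rainbow_on c' W (P \<union> Y \<union> {z1, z2})" using rb by (simp add: Un_ac)
  ultimately show ?thesis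
    unfolding tethered_def using teth Y W unfolding tethered_def by auto
qed

lemma tethered_even:
  assumes teth: "tethered c P U" and ear: "ear U v N" "even N"
  shows "\<exists>c' P'. tethered c' P' (U \<union> v ` {1..N}) \<and> card P' = card P + N div 2"
proof -
  have fP: "finite P" and rb: "rainbow_on c U (P \<union> {z1, z2})"
    using teth unfolding tethered_def by auto
  obtain c' Y where c': "rainbow_on c' (U \<union> v ` {1..N}) (P \<union> {z1, z2} \<union> Y)" "finite Y"
    "card Y = Suc N div 2" "Y \<inter> (P \<union> {z1, z2}) = {}" "\<And>e. e \<subseteq> U \<Longrightarrow> c' e = c e"
    "\<And>x. x \<in> v ` {1..N} \<Longrightarrow> \<exists>e\<in>{v 0, v (Suc N)}. rcon c' (U \<union> v ` {1..N}) Y x e"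
    by (rule extend_ear[OF rb _ _ ear(1)]) (use fP in auto)
  have "tethered c' (P \<union> Y) (U \<union> v ` {1..N})"
  proof (rule tethered_extend[OF teth refl c'(1,2,4,5)])
    fix x g assume "x \<in> v ` {1..N}"
    then show "(\<exists>e\<in>U. rcon c' (U \<union> v ` {1..N}) Y x e) \<or>
        (\<exists>s\<in>S. rcon c' (U \<union> v ` {1..N}) (insert g Y) x s)"
      using c'(6)[of x] ear unfolding ear_def by blast
  qed
  moreover have "card (P \<union> Y) = card P + N div 2"
    using c' fP ear by (subst card_Un_disjoint) auto
  ultimately show ?thesis by blast
qed

lemma tethered_odd:
  assumes teth: "tethered c P U" and ear: "ear U v N" "odd N" "v 0 \<in> S" "v (Suc N) \<in> S"
  shows "\<exists>c' P'. tethered c' P' (U \<union> v ` {1..N}) \<and> card P' = card P + N div 2"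
proof -
  let ?P = "P \<union> {z1, z2}"
  have fP: "finite P" and rb: "rainbow_on c U ?P" and rbS: "rainbow_on c S PS"
    and zP: "z1 \<notin> P" "z2 \<notin> P" "PS \<subseteq> P" "S \<subseteq> U"
    using teth unfolding tethered_def by auto
  \<comment> \<open>The tether of \<open>w\<close> that uses \<open>z2\<close> leads to
    \<open>S\<close>, and colours of \<open>PS\<close> lead on to \<open>v 0\<close>;
    \<open>z1\<close> is spared throughout.\<close>
  have cover: "rcon c U (?P - {z1}) (v 0) w" if w: "w \<in> U" for w
  proof -
    obtain s where s: "s \<in> S" "rcon c U (insert z2 (P - PS)) w s"
      using teth w unfolding tethered_def by blast
    have "rcon c S PS s (v 0)" using rainbow_onD[OF rbS s(1) ear(3)] .
    then have "rcon c U PS s (v 0)" by (rule rcon_transfer) (use zP in auto)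
    then have "rcon c U (insert z2 (P - PS) \<union> PS) w (v 0)"
      by (rule rcon_trans[OF s(2)]) (use z in auto)
    then have "rcon c U (?P - {z1}) w (v 0)" by (rule rcon_mono) (use zP z in auto)
    then show ?thesis by (rule rcon_sym)
  qed
  obtain c' Y where c': "rainbow_on c' (U \<union> v ` {1..N}) (?P \<union> Y)" "finite Y"
    "card Y = N div 2" "Y \<inter> ?P = {}" "\<And>e. e \<subseteq> U \<Longrightarrow> c' e = c e"
    "\<And>x g. x \<in> v ` {1..N} \<Longrightarrow> g \<in> {z1, z2} \<Longrightarrow>
      \<exists>e\<in>{v 0, v (Suc N)}. rcon c' (U \<union> v ` {1..N}) (insert g Y) x e"
    by (rule extend_odd_ear[OF rb _ _ _ z(1) ear(1,2)]) (use fP cover in auto)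
  have "tethered c' (P \<union> Y) (U \<union> v ` {1..N})"
  proof (rule tethered_extend[OF teth refl c'(1,2,4,5)])
    fix x g assume "x \<in> v ` {1..N}" "g \<in> {z1, z2}"
    then show "(\<exists>e\<in>U. rcon c' (U \<union> v ` {1..N}) Y x e) \<or>
        (\<exists>s\<in>S. rcon c' (U \<union> v ` {1..N}) (insert g Y) x s)"
      using c'(6)[of x g] ear by blast
  qed
  moreover have "card (P \<union> Y) = card P + N div 2"
    using c' fP ear by (subst card_Un_disjoint) auto
  ultimately show ?thesis by blast
qed

text \<open>\<open>U - S\<close> is a union of components of \<open>G - S\<close>.\<close>

definition sealed :: "'a set \<Rightarrow> bool" where
  "sealed U \<longleftrightarrow> (\<forall>x\<in>U - S. \<forall>y. {x, y} \<in> E \<longrightarrow> y \<in> U)"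

text \<open>The opening odd ear of a component costs \<open>N div 2\<close> private colours for
  \<open>N\<close> vertices, which gains the 1 as soon as \<open>U\<close> exceeds \<open>S\<close>.
  This gain leads to the final constant.\<close>

definition cheap :: "'a set \<Rightarrow> bool" where
  "cheap U \<longleftrightarrow> (\<exists>c P. tethered c P U \<and> 2 * card P + (if U = S then 0 else 1) \<le> card U)"

lemma cheapI: "tethered c P U \<Longrightarrow> 2 * card P + 1 \<le> card U \<Longrightarrow> cheap U"
  unfolding cheap_def by (intro exI[of _ c] exI[of _ P]) auto

lemma another_S: "\<exists>x'\<in>S. x' \<noteq> x"
proof (rule ccontr)
  assume "\<not> ?thesis"
  then have "S \<subseteq> {x}" by blast
  then have "card S \<le> 1" using card_mono[of "{x}" S] by auto
  then show False using S_card card_PS by auto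
qed

text \<open>The neighbour \<open>v N\<close> of the end lies outside \<open>U\<close>, whereas a
  vertex of \<open>U - S\<close> has all its neighbours in \<open>U\<close>.\<close>

lemma ear_end:
  assumes "sealed U" "ear X v N" "U \<subseteq> X" "v (Suc N) \<in> U"
  shows "v (Suc N) \<in> S"
proof (rule ccontr)
  assume "v (Suc N) \<notin> S"
  moreover have "{v (Suc N), v N} \<in> E" "v N \<notin> X"
    using assms(2) unfolding ear_def image_subset_iff by (auto simp: insert_commute)
  ultimately show False using assms unfolding sealed_def by blast
qed

text \<open>Adds one whole component of \<open>G - S\<close>: it starts with an odd ear of \<open>S\<close> and is exhausted by even
  ears.\<close>

lemma exists_larger:
  assumes U: "S \<subseteq> U" "U \<subseteq> V" "sealed U" "cheap U" "U \<noteq> V"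
  shows "\<exists>U'. U \<subset> U' \<and> U' \<subseteq> V \<and> sealed U' \<and> cheap U'"
proof -
  have "U \<noteq> {}" using U another_S by blast
  then obtain x y where xy: "x \<in> U" "y \<in> V - U" "{x, y} \<in> E"
    using boundary_edge[OF U(2) _ U(5)] by blast
  then have "x \<in> S" using U(3) unfolding sealed_def by blast
  obtain x' where "x' \<in> S" "x' \<noteq> x" using another_S by blast
  then obtain v N where v: "ear U v N" "v 0 = x"
    using ear_exists[OF U(2) xy(1) _ _ xy(2,3)] U(1) by blast
  then have "v (Suc N) \<in> S" using ear_end[OF U(3) v(1)] unfolding ear_def by blast
  then have vS: "ear S v N" using ear_subset[OF v(1) U(1)] v \<open>x \<in> S\<close> by blast
  \<comment> \<open>Candidates for \<open>S\<close> together with a part of the new component; a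
    maximal one will turn out to be exhausted.\<close>
  define Ts where "Ts = {T. tame T \<and> T \<inter> U = S \<and> cheap (U \<union> T)}"
  have "S \<union> v ` {1..N} \<in> Ts"
  proof -
    obtain c P where cP: "tethered c P U" "2 * card P + (if U = S then 0 else 1) \<le> card U"
      using U(4) unfolding cheap_def by blast
    obtain c' P' where c': "tethered c' P' (U \<union> v ` {1..N})" "card P' = card P + N div 2"
      using tethered_odd[OF cP(1) v(1) ear_S_odd[OF vS]] v \<open>x \<in> S\<close> \<open>v (Suc N) \<in> S\<close> by blast
    have "2 * (N div 2) + 1 = N" using ear_S_odd[OF vS] by simp
    then have "2 * card P' + 1 \<le> card (U \<union> v ` {1..N})"
      using c' cP ear_card[OF v(1) fin[OF U(2)]] by linarith
    then have "cheap (U \<union> v ` {1..N})" using c'(1) cheapI by blast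
    moreover have "U \<union> (S \<union> v ` {1..N}) = U \<union> v ` {1..N}" using U by auto
    moreover have "(S \<union> v ` {1..N}) \<inter> U = S" using U v unfolding ear_def by auto
    ultimately show ?thesis using tame_base[OF vS] unfolding Ts_def by simp
  qed
  moreover have "finite Ts"
    by (rule finite_subset[of _ "Pow V"]) (use finite_V in \<open>auto simp: Ts_def tame_def\<close>)
  ultimately obtain T where T: "T \<in> Ts" and Tmax: "\<And>T'. T' \<in> Ts \<Longrightarrow> T \<subseteq> T' \<Longrightarrow> T' = T"
    using finite_has_maximal2 by (metis order_refl)
  have tT: "tame T" "T \<inter> U = S" "cheap (U \<union> T)" "S \<subset> T" "T \<subseteq> V"
    using T unfolding Ts_def tame_def by auto
  \<comment> \<open>An edge leaving the set would start in \<open>T - S\<close>, because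
    \<open>U\<close> is sealed, and extend to an ear of \<open>T\<close>. Tameness makes that ear
    even, since one end is not in \<open>S\<close>; adding it contradicts the maximality of
    \<open>T\<close>.\<close>
  have "sealed (U \<union> T)"
  proof (rule ccontr)
    assume "\<not> sealed (U \<union> T)"
    then obtain a b where ab: "a \<in> U \<union> T" "a \<notin> S" "{a, b} \<in> E" "b \<notin> U \<union> T"
      unfolding sealed_def by blast
    then have a: "a \<in> T" "a \<notin> U" using U(3) unfolding sealed_def by blast+
    have "b \<in> V - (U \<union> T)" using ab edge_in_V by blast
    moreover obtain x' where x': "x' \<in> S" "x' \<noteq> a" using another_S by blast
    then have "x' \<in> U \<union> T" using U(1) by blast
    moreover have UTV: "U \<union> T \<subseteq> V" using U tT by blast
    ultimately obtain w M where w: "ear (U \<union> T) w M" "w 0 = a"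
      using ear_exists[OF UTV ab(1) _ x'(2) _ ab(3)] by blast
    have "w (Suc M) \<in> T"
      using ear_end[OF U(3) w(1)] w(1) tT unfolding ear_def by blast
    then have wT: "ear T w M" using ear_subset[OF w(1)] w(2) a by blast
    have ev: "even M" using tT(1) wT w(2) ab(2) unfolding tame_def by blast
    obtain c P where cP: "tethered c P (U \<union> T)" "2 * card P + 1 \<le> card (U \<union> T)"
      using tT(3,4) U(1) unfolding cheap_def by (auto split: if_splits)
    obtain c' P' where c': "tethered c' P' (U \<union> T \<union> w ` {1..M})" "card P' = card P + M div 2"
      using tethered_even[OF cP(1) w(1) ev] by blast
    have "2 * card P' + 1 \<le> card (U \<union> T \<union> w ` {1..M})"
      using c' cP ev ear_card[OF w(1) fin[OF UTV]] by auto
    then have "cheap (U \<union> T \<union> w ` {1..M})" using c'(1) cheapI by blast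
    moreover have "(T \<union> w ` {1..M}) \<inter> U = S" using tT(2) w(1) unfolding ear_def by auto
    ultimately have "T \<union> w ` {1..M} \<in> Ts"
      using tame_step[OF tT(1) wT ev] unfolding Ts_def by (simp add: Un_assoc)
    then show False using Tmax[of "T \<union> w ` {1..M}"] ear_psubset[OF wT] by blast
  qed
  moreover have "U \<subset> U \<union> T" using tT(2,4) by blast
  moreover have "U \<union> T \<subseteq> V" using U(2) tT(5) by blast
  ultimately show ?thesis using tT(3) by (intro exI[of _ "U \<union> T"] conjI)
qed

lemma cheap_V: "cheap V"
proof -
  define Us where "Us = {U. S \<subseteq> U \<and> U \<subseteq> V \<and> sealed U \<and> cheap U}"
  have "S \<in> Us"
    using tethered_S S_card SV unfolding Us_def cheap_def sealed_def by auto
  moreover have "finite Us"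
    by (rule finite_subset[of _ "Pow V"]) (use finite_V in \<open>auto simp: Us_def\<close>)
  ultimately obtain U where U: "U \<in> Us" and max: "\<And>U'. U' \<in> Us \<Longrightarrow> U \<subseteq> U' \<Longrightarrow> U' = U"
    using finite_has_maximal2 by (metis order_refl)
  have "U = V"
  proof (rule ccontr)
    assume "U \<noteq> V"
    then obtain U' where U': "U \<subset> U'" "U' \<subseteq> V" "sealed U'" "cheap U'"
      using exists_larger[of U] U unfolding Us_def mem_Collect_eq by metis
    then have "U' \<in> Us" using U unfolding Us_def mem_Collect_eq by (meson order_trans psubset_imp_subset)
    then show False using max[of U'] U' by auto
  qed
  then show ?thesis using U unfolding Us_def by simp
qed

text \<open>Outside the case \<open>V = S\<close>, adding \<open>z1\<close> and \<open>z2\<close> to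
  the private palette gives \<open>2 * (card P + 2) \<le> card V + 3\<close>.\<close>

lemma rc_bound_saturated: "2 * rc V E \<le> card V + 3"
proof (cases "V = S")
  case True
  then have "rc V E \<le> card PS" using rc_le S_rb PS by blast
  then show ?thesis using S_card True by simp
next
  case False
  then obtain c P where c: "tethered c P V" "2 * card P + 1 \<le> card V"
    using cheap_V unfolding cheap_def by auto
  then have "rainbow_on c V (P \<union> {z1, z2})" "finite P" unfolding tethered_def by auto
  then have "rc V E \<le> card (P \<union> {z1, z2})" using rc_le by blast
  also have "\<dots> \<le> card P + 2"
    using card_Un_le[of P "{z1, z2}"] z by auto
  finally show ?thesis using c by simp
qed

end

lemma (in two_connected) rc_bound: "2 * rc V E \<le> card V + 3"
proof -
  have "finite {W. rich W}"
    by (rule finite_subset[of _ "Pow V"]) (use finite_V in \<open>auto simp: rich_def\<close>)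
  moreover obtain W where "W \<in> {W. rich W}" using rich_exists by blast
  ultimately obtain S where S: "rich S" and max: "\<And>W. rich W \<Longrightarrow> S \<subseteq> W \<Longrightarrow> W = S"
    using finite_has_maximal2[of "{W. rich W}" W] by auto
  obtain c P where c: "S \<subseteq> V" "rainbow_on c S P" "finite P" "P \<noteq> {}" "2 * card P \<le> card S"
    using S unfolding rich_def by blast
  obtain z1 where "z1 \<notin> P" using ex_new_if_finite[OF _ c(3)] by auto
  moreover obtain z2 where "z2 \<notin> insert z1 P" using ex_new_if_finite[of "insert z1 P"] c(3) by auto
  ultimately interpret saturated V E S c P z1 z2
    using c max by unfold_locales auto
  show ?thesis by (rule rc_bound_saturated)
qed

theorem theorem3:
  fixes V :: "'a set" and E :: "'a set set"
  assumes "simple_graph V E"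
    and "vertex_connected 2 V E"
  shows "int (rc V E) \<le> \<lceil>real (card V) / 2\<rceil> + 1"
proof -
  interpret two_connected V E using assms by unfold_locales
  \<comment> \<open>By the characterisation of the ceiling the claim is
    \<open>rc V E - 2 < card V / 2\<close> over the reals, that is,
    \<open>2 * rc V E \<le> card V + 3\<close>.\<close>
  have "int (rc V E) - 1 \<le> \<lceil>real (card V) / 2\<rceil>"
    unfolding le_ceiling_iff using rc_bound by simp
  then show ?thesis by simp
qed

end
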